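(* For each integer $k\ge1$, the number $R_k:=\frac{d^k}{dt^k}\log\theta(t)\big|_{t=1}$ lies in $\mathbb Q[\psi_2]$, where $\psi_2:=\pi\theta(1)^4=\frac{\pi^2}{\Gamma(3/4)^4}$; more precisely, $R_k=P_k(\psi_2)$ for an even polynomial $P_k\in\mathbb Q[X]$ of degree at most $k$.
   Context: $\theta(t)=\sum_{n\in\mathbb Z}e^{-\pi n^2t}$ for $t>0$. *)

theory Defs
  imports "HOL-Analysis.Analysis" "HOL-Computational_Algebra.Polynomial"
begin

text \<open>The series converges absolutely exactly when \<open>t > 0\<close>; for \<open>t \<le> 0\<close> the value is the default
  \<open>0\<close> of \<^const>\<open>infsum\<close> and is irrelevant.\<close>

definition theta :: "real \<Rightarrow> real" where
  "theta t = (\<Sum>\<^sub>\<infinity>n::int. exp (- pi * (of_int n)\<^sup>2 * t))"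

definition R :: "nat \<Rightarrow> real" where
  "R k = (deriv ^^ k) (\<lambda>t. ln (theta t)) 1"

definition psi2 :: real where
  "psi2 = pi * theta 1 ^ 4"

end

theory Submission
  imports Defs
begin

text \<open>
  Write \<open>q = exp (- \<pi> t)\<close>, \<open>x = \<theta>(q)\<^sup>2\<close> and \<open>y = \<theta>(- q)\<^sup>2\<close>. Replacing \<open>q\<close> by \<open>q\<^sup>2\<close> replaces
  \<open>(x, y)\<close> by its arithmetic and geometric means. Hence each quantity below can be identified by
  its behaviour under one such step together with its limit for \<open>q \<rightarrow> 0\<close>; no complex analysis and
  no Poisson summation are needed.

  This yields a closed system of differential equations for \<open>\<ell> = (log \<theta>)'\<close>, \<open>s = \<pi> \<theta>\<^sup>4\<close> and
  \<open>u = s - 2 \<pi> y\<^sup>2\<close>, in which \<open>s\<close> enters the equations for \<open>\<ell>\<close> and \<open>u\<close> only through \<open>s\<^sup>2\<close>: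
  \<open>\<ell>' = 2 \<ell>\<^sup>2 + (s\<^sup>2 - u\<^sup>2) / 32\<close>, \<open>u' = 4 \<ell> u - (s\<^sup>2 - u\<^sup>2) / 2\<close>, \<open>s' = 4 \<ell> s\<close>.
  So the \<open>k\<close>-th derivative of \<open>log \<theta>\<close> is a rational polynomial in \<open>\<ell>\<close>, \<open>u\<close>, \<open>s\<^sup>2\<close>, homogeneous of
  degree \<open>k\<close> for the weights 1, 1, 2. With the elliptic integral
  \<open>I(a, b) = \<integral> d\<phi> / sqrt (a\<^sup>2 cos\<^sup>2 \<phi> + b\<^sup>2 sin\<^sup>2 \<phi>)\<close>, which is invariant under the mean step, one
  finds \<open>I(x, y) = \<pi> / 2\<close> and \<open>I(x, sqrt (x\<^sup>2 - y\<^sup>2)) = \<pi> t / 2\<close>. This gives the inversion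
  \<open>\<theta>(1 / t)\<^sup>2 = t \<theta>(t)\<^sup>2\<close>, the values \<open>\<ell> = - 1 / 4\<close> and \<open>u = 0\<close> at \<open>t = 1\<close>, and, through the lemniscatic
  integral, \<open>\<theta>(1)\<close>.
\<close>

section \<open>The theta series as a function of the nome\<close>

text \<open>The natural exponent admits nonpositive nomes: a negative argument yields the
  alternating series, classically theta_4, and 0 is the point where all limits are taken.\<close>

definition nome_theta :: "real \<Rightarrow> real" where
  "nome_theta q = (\<Sum>\<^sub>\<infinity>n::int. q ^ nat (n\<^sup>2))"

text \<open>The number of integers with square \<open>n\<close>. These are the coefficients of theta
  as an ordinary power series in the nome, the form to which termwise differentiation
  applies.\<close>

definition square_coeff :: "nat \<Rightarrow> real" where
  "square_coeff n = (if n = 0 then 1 else if \<exists>m. n = m\<^sup>2 then 2 else 0)"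

lemma theta_eq_nome_theta: "theta t = nome_theta (exp (- pi * t))"
proof -
  have "exp (- pi * (of_int n)\<^sup>2 * t) = exp (- pi * t) ^ nat (n\<^sup>2)" for n :: int
  proof -
    have "exp (- pi * t) ^ nat (n\<^sup>2) = exp (real (nat (n\<^sup>2)) * (- pi * t))"
      by (rule exp_of_nat_mult[symmetric])
    also have "real (nat (n\<^sup>2)) = (of_int n)\<^sup>2"
      by (subst of_nat_nat) (simp_all del: of_nat_nat)
    also have "(of_int n)\<^sup>2 * (- pi * t) = - pi * (of_int n)\<^sup>2 * t"
      by (simp only: mult_ac)
    finally show ?thesis ..
  qed
  then show ?thesis unfolding theta_def nome_theta_def by presburger
qed

lemma summable_square_powers:
  fixes r :: real
  assumes "0 \<le> r" "r < 1"
  shows "summable (\<lambda>n. r ^ ((Suc n)\<^sup>2))"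
proof (rule summable_comparison_test')
  show "summable (\<lambda>n. r ^ n)" using assms by (intro summable_geometric) auto
  show "norm (r ^ ((Suc n)\<^sup>2)) \<le> r ^ n" if "n \<ge> 0" for n
  proof -
    have "n \<le> (Suc n)\<^sup>2" by (simp add: power2_eq_square)
    then have "r ^ ((Suc n)\<^sup>2) \<le> r ^ n" using assms by (intro power_decreasing) auto
    then show ?thesis using assms by simp
  qed
qed

text \<open>Folds a symmetric bilateral sum onto the positive integers, where the tools for series
  over the naturals are available.\<close>

lemma has_sum_int_even:
  fixes f :: "int \<Rightarrow> 'a :: banach"
  assumes even: "\<And>n. f (- n) = f n"
    and sm: "summable (\<lambda>n. norm (f (int (Suc n))))"
  shows "(f has_sum (f 0 + 2 *\<^sub>R (\<Sum>n. f (int (Suc n))))) UNIV"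
proof -
  have 1: "((\<lambda>n. f (int (Suc n))) has_sum (\<Sum>n. f (int (Suc n)))) UNIV"
    by (intro norm_summable_imp_has_sum sm summable_sums summable_norm_cancel)
  have 2: "(f has_sum (\<Sum>n. f (int (Suc n)))) {0<..}"
    by (rule iffD2[OF has_sum_reindex_bij_witness[of _ "\<lambda>n. int (Suc n)" "\<lambda>k. nat (k - 1)" UNIV] 1]) auto
  have 3: "(f has_sum (\<Sum>n. f (int (Suc n)))) {..<0}"
    by (rule iffD2[OF has_sum_reindex_bij_witness[of _ uminus uminus "{0<..}" f] 2]) (auto simp: even)
  have "(f has_sum (f 0 + ((\<Sum>n. f (int (Suc n))) + (\<Sum>n. f (int (Suc n)))))) ({0} \<union> ({0<..} \<union> {..<0}))"
    by (intro has_sum_Un_disjoint 2 3 has_sum_finiteI) auto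
  also have "{0} \<union> ({0<..} \<union> {..<0}) = (UNIV :: int set)" by auto
  finally show ?thesis by (simp add: scaleR_2)
qed

lemma nome_theta_has_sum:
  assumes "\<bar>q\<bar> < 1"
  shows "((\<lambda>n::int. q ^ nat (n\<^sup>2)) has_sum nome_theta q) UNIV"
    and "(\<lambda>n::int. \<bar>q\<bar> ^ nat (n\<^sup>2)) summable_on UNIV"
    and "nome_theta q = 1 + 2 * (\<Sum>n. q ^ ((Suc n)\<^sup>2))"
proof -
  have nat: "nat ((int (Suc n))\<^sup>2) = (Suc n)\<^sup>2" for n
    by (metis nat_int of_nat_power)
  have *: "((\<lambda>n::int. q ^ nat (n\<^sup>2)) has_sum (1 + 2 * (\<Sum>n. q ^ ((Suc n)\<^sup>2)))) UNIV" if "\<bar>q\<bar> < 1" for q :: real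
    using has_sum_int_even[of "\<lambda>n::int. q ^ nat (n\<^sup>2)"] summable_square_powers[of "\<bar>q\<bar>"] that
    unfolding nat by (simp add: power_abs)
  show "nome_theta q = 1 + 2 * (\<Sum>n. q ^ ((Suc n)\<^sup>2))"
    unfolding nome_theta_def using *[OF assms] by (rule infsumI)
  with *[OF assms] show "((\<lambda>n::int. q ^ nat (n\<^sup>2)) has_sum nome_theta q) UNIV" by simp
  show "(\<lambda>n::int. \<bar>q\<bar> ^ nat (n\<^sup>2)) summable_on UNIV"
    using *[of "\<bar>q\<bar>"] assms by (intro has_sum_imp_summable) auto
qed

lemma nome_theta_powser:
  assumes "\<bar>q\<bar> < 1"
  shows "(\<lambda>n. square_coeff n * q ^ n) sums nome_theta q"
proof -
  \<comment> \<open>The constant term is split off because \<open>(Suc n)^2\<close> enumerates only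
    the positive squares; at all other positive indices the coefficient is 0.\<close>
  define f where "f = (\<lambda>n. if n = 0 then 0 else square_coeff n * q ^ n)"
  have mono: "strict_mono (\<lambda>n. (Suc n)\<^sup>2)" by (intro strict_monoI power_strict_mono) auto
  have zero: "f n = 0" if "n \<notin> range (\<lambda>n. (Suc n)\<^sup>2)" for n
  proof -
    have False if "n = m\<^sup>2" "n \<noteq> 0" for m
      using that \<open>n \<notin> range (\<lambda>n. (Suc n)\<^sup>2)\<close> by (cases m) auto
    then show ?thesis by (auto simp: f_def square_coeff_def)
  qed
  have sq: "f ((Suc n)\<^sup>2) = 2 * q ^ ((Suc n)\<^sup>2)" for n
    by (auto simp: f_def square_coeff_def)
  have "(\<lambda>n. 2 * q ^ ((Suc n)\<^sup>2)) sums (2 * (\<Sum>n. q ^ ((Suc n)\<^sup>2)))"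
    by (intro sums_mult summable_sums, rule summable_norm_cancel)
      (use summable_square_powers[of "\<bar>q\<bar>"] assms in \<open>simp add: power_abs\<close>)
  then have "f sums (2 * (\<Sum>n. q ^ ((Suc n)\<^sup>2)))"
    using sums_mono_reindex[of _ f, OF mono zero] unfolding sq by blast
  moreover have "(\<lambda>n. if n = 0 then 1 else 0) sums (1 :: real)"
    by (rule sums_single)
  ultimately have "(\<lambda>n. (if n = 0 then 1 else 0) + f n) sums (1 + 2 * (\<Sum>n. q ^ ((Suc n)\<^sup>2)))"
    by (intro sums_add) simp_all
  also have "(\<lambda>n. (if n = 0 then 1 else 0) + f n) = (\<lambda>n. square_coeff n * q ^ n)"
    by (auto simp: f_def square_coeff_def)
  finally show ?thesis using nome_theta_has_sum(3)[OF assms] by simp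
qed

definition nome_theta' :: "real \<Rightarrow> real" where
  "nome_theta' q = (\<Sum>n. diffs square_coeff n * q ^ n)"

definition nome_theta'' :: "real \<Rightarrow> real" where
  "nome_theta'' q = (\<Sum>n. diffs (diffs square_coeff) n * q ^ n)"

text \<open>The power series is smooth at 0 and on both sides of it, so limits at 0 and derivatives
  at \<open>- q\<close> come from the same statement.\<close>

lemma nome_theta_derivs:
  assumes "\<bar>q\<bar> < 1"
  shows "(nome_theta has_field_derivative nome_theta' q) (at q)"
    and "(nome_theta' has_field_derivative nome_theta'' q) (at q)"
    and "isCont nome_theta'' q"
proof -
  have s0: "summable (\<lambda>n. square_coeff n * z ^ n)" if "norm z < 1" for z :: real
    using nome_theta_powser[of z] that by (auto intro: sums_summable)
  have s1: "summable (\<lambda>n. diffs square_coeff n * z ^ n)" if "norm z < 1" for z :: real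
    using termdiff_converges[OF that s0] .
  have s2: "summable (\<lambda>n. diffs (diffs square_coeff) n * z ^ n)" if "norm z < 1" for z :: real
    using termdiff_converges[OF that s1] .
  have "((\<lambda>q. \<Sum>n. square_coeff n * q ^ n) has_field_derivative nome_theta' q) (at q)"
    unfolding nome_theta'_def by (rule termdiffs_strong'[OF s0]) (use assms in auto)
  moreover have "\<forall>\<^sub>F q in nhds q. (\<Sum>n. square_coeff n * q ^ n) = nome_theta q"
  proof -
    have "\<forall>\<^sub>F q in nhds q. q \<in> {-1<..<1::real}"
      using assms by (intro eventually_nhds_in_open) auto
    then show ?thesis
      by eventually_elim (use nome_theta_powser in \<open>auto simp: sums_iff\<close>)
  qed
  ultimately show "(nome_theta has_field_derivative nome_theta' q) (at q)"
    by (subst (asm) DERIV_cong_ev[OF refl _ refl])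
  show "(nome_theta' has_field_derivative nome_theta'' q) (at q)"
    unfolding nome_theta'_def nome_theta''_def
    by (rule termdiffs_strong'[OF s1]) (use assms in auto)
  show "isCont nome_theta'' q"
    unfolding nome_theta''_def
    by (rule DERIV_isCont, rule termdiffs_strong'[OF s2]) (use assms in auto)
qed

lemma nome_theta_at_0 [simp]: "nome_theta 0 = 1" "nome_theta' 0 = 2"
proof -
  show "nome_theta 0 = 1"
    using nome_theta_powser[of 0] sums_unique2[OF powser_sums_zero[of square_coeff]]
    by (simp add: square_coeff_def)
  have "\<exists>m. Suc 0 = m\<^sup>2" by (rule exI[of _ 1]) simp
  then show "nome_theta' 0 = 2"
    unfolding nome_theta'_def powser_zero by (simp add: diffs_def square_coeff_def)
qed

section \<open>Products of two theta series as lattice sums, and the doubling identities\<close>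

lemma nome_theta_mult_has_sum:
  assumes q: "\<bar>q\<bar> < 1" and r: "\<bar>r\<bar> < 1"
  shows "((\<lambda>(m::int, n::int). q ^ nat (m\<^sup>2) * r ^ nat (n\<^sup>2)) has_sum (nome_theta q * nome_theta r)) UNIV"
proof -
  let ?f = "\<lambda>(m::int, n::int). q ^ nat (m\<^sup>2) * r ^ nat (n\<^sup>2)"
  \<comment> \<open>Absolute summability over the lattice permits evaluating the double sum row by
    row.\<close>
  have "(\<lambda>x. norm (?f x)) summable_on (UNIV \<times> UNIV)"
    unfolding Infinite_Sum.abs_summable_on_Sigma_iff
    using nome_theta_has_sum(2)[OF q] nome_theta_has_sum(2)[OF r]
    by (auto simp: abs_mult power_abs infsum_cmult_right' intro!: summable_on_cmult_right summable_on_cmult_left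
          simp del: abs_power2 intro: infsum_nonneg)
  then have "?f summable_on (UNIV \<times> UNIV)" by (rule abs_summable_summable)
  then have s: "(?f has_sum (infsum ?f (UNIV \<times> UNIV))) (UNIV \<times> UNIV)" by simp
  have "((\<lambda>m. q ^ nat (m\<^sup>2) * nome_theta r) has_sum (infsum ?f (UNIV \<times> UNIV))) UNIV"
    by (rule has_sum_Sigma'[OF s]) (use nome_theta_has_sum(1)[OF r] in \<open>auto intro!: has_sum_cmult_right\<close>)
  moreover have "((\<lambda>m. q ^ nat (m\<^sup>2) * nome_theta r) has_sum (nome_theta q * nome_theta r)) UNIV"
    by (intro has_sum_cmult_left nome_theta_has_sum(1)[OF q])
  ultimately have "infsum ?f (UNIV \<times> UNIV) = nome_theta q * nome_theta r"
    by (rule has_sum_unique)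
  with s show ?thesis by simp
qed

text \<open>Rotating the lattice by 45 degrees, \<open>(m, n) = (a + b, a - b)\<close>, turns \<open>m\<^sup>2 + n\<^sup>2\<close>
  into \<open>2 (a\<^sup>2 + b\<^sup>2)\<close>.\<close>

lemma has_sum_rotated_lattice:
  fixes f :: "int \<times> int \<Rightarrow> real"
  assumes "(f has_sum s) UNIV" and "\<And>m n. odd (m + n) \<Longrightarrow> f (m, n) = 0"
  shows "((\<lambda>(a, b). f (a + b, a - b)) has_sum s) UNIV"
proof -
  \<comment> \<open>Only the sublattice of points with even coordinate sum carries nonzero terms,
    and the rotation maps the whole lattice bijectively onto it.\<close>
  have *: "(f has_sum s) {(m, n). even (m + n)}"
    using assms by (subst has_sum_cong_neutral[of UNIV _ f f]) auto
  show ?thesis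
    by (rule iffD2[OF has_sum_reindex_bij_witness[of UNIV "\<lambda>(m, n). ((m + n) div 2, (m - n) div 2)"
          "\<lambda>(a, b). (a + b, a - b)" "{(m, n). even (m + n)}" f] *])
      (auto, presburger+)
qed

lemma minus_power_nat_square: "(- q :: real) ^ nat (n\<^sup>2) = (if even n then 1 else -1) * q ^ nat (n\<^sup>2)"
  by (subst power_minus) (auto simp: even_nat_iff)

lemma power_nat_square_rotate:
  fixes q :: real and a b :: int
  shows "q ^ nat ((a + b)\<^sup>2) * q ^ nat ((a - b)\<^sup>2) = (q\<^sup>2) ^ nat (a\<^sup>2) * (q\<^sup>2) ^ nat (b\<^sup>2)"
proof -
  have "int (nat ((a + b)\<^sup>2) + nat ((a - b)\<^sup>2)) = (a + b)\<^sup>2 + (a - b)\<^sup>2"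
    by (simp del: power2_diff power2_sum)
  also have "\<dots> = 2 * a\<^sup>2 + 2 * b\<^sup>2"
    by (simp add: power2_sum power2_diff)
  also have "\<dots> = int (2 * nat (a\<^sup>2) + 2 * nat (b\<^sup>2))"
    by simp
  finally have "nat ((a + b)\<^sup>2) + nat ((a - b)\<^sup>2) = 2 * nat (a\<^sup>2) + 2 * nat (b\<^sup>2)"
    by (simp only: of_nat_eq_iff)
  then show ?thesis
    by (simp only: power_add[symmetric] power_mult[symmetric])
qed

text \<open>The sign of a lattice term at \<open>- q\<close> is (-1)^(m+n). Adding the two squares
  doubles the points of even parity and kills the others; rotating the survivors turns the nome into
  its square. This is the arithmetic mean in the mean step.\<close>

lemma nome_theta_square_add:
  assumes q: "\<bar>q\<bar> < 1"
  shows "(nome_theta q)\<^sup>2 + (nome_theta (- q))\<^sup>2 = 2 * (nome_theta (q\<^sup>2))\<^sup>2"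
proof -
  let ?f = "\<lambda>(m, n). q ^ nat (m\<^sup>2) * q ^ nat (n\<^sup>2) + (- q) ^ nat (m\<^sup>2) * (- q) ^ nat (n\<^sup>2)"
  have "((\<lambda>(m, n). q ^ nat (m\<^sup>2) * q ^ nat (n\<^sup>2)) has_sum nome_theta q * nome_theta q) UNIV"
    "((\<lambda>(m, n). (- q) ^ nat (m\<^sup>2) * (- q) ^ nat (n\<^sup>2)) has_sum nome_theta (-q) * nome_theta (-q)) UNIV"
    using q by (auto intro!: nome_theta_mult_has_sum)
  from has_sum_add[OF this]
  have "(?f has_sum (nome_theta q * nome_theta q + nome_theta (-q) * nome_theta (-q))) UNIV"
    by (simp add: case_prod_unfold)
  then have "((\<lambda>(a, b). ?f (a + b, a - b)) has_sum (nome_theta q * nome_theta q + nome_theta (-q) * nome_theta (-q))) UNIV"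
    by (rule has_sum_rotated_lattice) (auto simp: minus_power_nat_square)
  also have "(\<lambda>(a, b). ?f (a + b, a - b)) = (\<lambda>(a, b). 2 * ((q\<^sup>2) ^ nat (a\<^sup>2) * (q\<^sup>2) ^ nat (b\<^sup>2)))"
    by (auto simp: fun_eq_iff minus_power_nat_square power_nat_square_rotate[symmetric])
  finally have "((\<lambda>(a, b). 2 * ((q\<^sup>2) ^ nat (a\<^sup>2) * (q\<^sup>2) ^ nat (b\<^sup>2))) has_sum
    (nome_theta q * nome_theta q + nome_theta (-q) * nome_theta (-q))) UNIV" .
  moreover have "((\<lambda>(a, b). 2 * ((q\<^sup>2) ^ nat (a\<^sup>2) * (q\<^sup>2) ^ nat (b\<^sup>2))) has_sum
    2 * (nome_theta (q\<^sup>2) * nome_theta (q\<^sup>2))) UNIV"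
    using has_sum_cmult_right[OF nome_theta_mult_has_sum[of "q\<^sup>2" "q\<^sup>2"], of 2] q
    by (simp add: case_prod_unfold abs_square_less_1)
  ultimately show ?thesis
    using has_sum_unique by (fastforce simp: power2_eq_square)
qed

text \<open>Symmetrising gives the sign (-1)^m + (-1)^n, which again vanishes for odd m + n. After
  rotation both signs are (-1)^(a+b), exactly the sign pattern of the nome \<open>- (q^2)\<close>.
  This is the geometric mean in the mean step.\<close>

lemma nome_theta_mult_minus:
  assumes q: "\<bar>q\<bar> < 1"
  shows "nome_theta q * nome_theta (- q) = (nome_theta (- (q\<^sup>2)))\<^sup>2"
proof -
  let ?f = "\<lambda>(m, n). (q ^ nat (m\<^sup>2) * (- q) ^ nat (n\<^sup>2) + (- q) ^ nat (m\<^sup>2) * q ^ nat (n\<^sup>2))"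
  have "((\<lambda>(m, n). q ^ nat (m\<^sup>2) * (- q) ^ nat (n\<^sup>2)) has_sum nome_theta q * nome_theta (- q)) UNIV"
    "((\<lambda>(m, n). (- q) ^ nat (m\<^sup>2) * q ^ nat (n\<^sup>2)) has_sum nome_theta (-q) * nome_theta q) UNIV"
    using q by (auto intro!: nome_theta_mult_has_sum)
  from has_sum_add[OF this]
  have "(?f has_sum (2 * (nome_theta q * nome_theta (- q)))) UNIV"
    by (simp add: case_prod_unfold mult.commute)
  then have "((\<lambda>(a, b). ?f (a + b, a - b)) has_sum (2 * (nome_theta q * nome_theta (- q)))) UNIV"
    by (rule has_sum_rotated_lattice) (auto simp: minus_power_nat_square)
  also have "(\<lambda>(a, b). ?f (a + b, a - b)) = (\<lambda>(a, b). 2 * ((- (q\<^sup>2)) ^ nat (a\<^sup>2) * (- (q\<^sup>2)) ^ nat (b\<^sup>2)))"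
    by (auto simp: fun_eq_iff minus_power_nat_square power_nat_square_rotate[symmetric])
  finally have "((\<lambda>(a, b). 2 * ((- (q\<^sup>2)) ^ nat (a\<^sup>2) * (- (q\<^sup>2)) ^ nat (b\<^sup>2))) has_sum
    (2 * (nome_theta q * nome_theta (- q)))) UNIV" .
  moreover have "((\<lambda>(a, b). 2 * ((- (q\<^sup>2)) ^ nat (a\<^sup>2) * (- (q\<^sup>2)) ^ nat (b\<^sup>2))) has_sum
    2 * (nome_theta (-(q\<^sup>2)) * nome_theta (-(q\<^sup>2)))) UNIV"
    using has_sum_cmult_right[OF nome_theta_mult_has_sum[of "-(q\<^sup>2)" "-(q\<^sup>2)"], of 2] q
    by (simp add: case_prod_unfold abs_square_less_1)
  ultimately show ?thesis
    using has_sum_unique by (fastforce simp: power2_eq_square)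
qed

section \<open>Differential equations in the nome\<close>

lemma nome_theta_ge_1:
  assumes "0 \<le> q" "q < 1"
  shows "nome_theta q \<ge> 1"
  using nome_theta_has_sum(3)[of q] assms
  by (auto intro!: suminf_nonneg summable_square_powers)

section \<open>Iteration of the squaring map on the nome; positivity\<close>

lemma filterlim_iterated_square:
  fixes q :: real
  assumes "q \<in> {0<..<1}"
  shows "filterlim (\<lambda>n. q ^ (2 ^ n)) (at_right 0) sequentially"
proof -
  have "(\<lambda>n. q ^ n) \<longlonglongrightarrow> 0" using assms by (intro LIMSEQ_realpow_zero) auto
  moreover have "strict_mono (\<lambda>n. 2 ^ n :: nat)" by (intro strict_monoI) simp
  ultimately have "((\<lambda>n. q ^ n) \<circ> (\<lambda>n. 2 ^ n)) \<longlonglongrightarrow> 0"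
    by (rule LIMSEQ_subseq_LIMSEQ)
  then show ?thesis
    using assms by (auto simp: o_def filterlim_at intro!: always_eventually)
qed

lemma squaring_recurrence_iterate:
  fixes h :: "real \<Rightarrow> real"
  assumes "\<And>q. q \<in> {0<..<1} \<Longrightarrow> h (q\<^sup>2) = c * h q" and "q \<in> {0<..<1}"
  shows "h (q ^ (2 ^ n)) = c ^ n * h q"
proof (induction n)
  case (Suc n)
  have "q ^ 2 ^ n \<in> {0<..<1}" using assms(2) by (auto simp: power_less_one_iff)
  from assms(1)[OF this] Suc show ?case by (simp add: power_mult[symmetric] mult_ac)
qed simp

text \<open>The orbit of every \<open>q\<close> in (0, 1) tends to 0, so an invariant function is
  constant along it and must equal its limit. This is how the closed forms below are
  identified.\<close>

lemma squaring_invariant_unique: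
  fixes h :: "real \<Rightarrow> real"
  assumes "\<And>q. q \<in> {0<..<1} \<Longrightarrow> h (q\<^sup>2) = h q" and "(h \<longlongrightarrow> l) (at_right 0)" and "q \<in> {0<..<1}"
  shows "h q = l"
proof -
  have "h (q ^ (2 ^ n)) = h q" for n
    using squaring_recurrence_iterate[of h 1 q n] assms by simp
  moreover have "(\<lambda>n. h (q ^ (2 ^ n))) \<longlonglongrightarrow> l"
    using filterlim_compose[OF assms(2) filterlim_iterated_square[OF assms(3)]] .
  ultimately show ?thesis by (simp add: LIMSEQ_const_iff)
qed

text \<open>Positivity holds near 0 by continuity, and \<open>nome_theta_mult_minus\<close> pulls it
  back from the square of the nome to the nome itself, since the other factor is at least 1.
  Finitely many such steps lead from a late point of the orbit back to \<open>q\<close>.\<close>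

lemma nome_theta_minus_pos:
  assumes q: "q \<in> {0<..<1}"
  shows "nome_theta (- q) > 0"
proof -
  have cont: "isCont nome_theta 0" using nome_theta_derivs(1)[of 0] by (intro DERIV_isCont) simp
  have "((\<lambda>q. nome_theta (- q)) \<longlongrightarrow> 1) (at_right 0)"
  proof -
    have "((\<lambda>q. nome_theta (- q)) \<longlongrightarrow> nome_theta 0) (at_right 0)"
      by (rule isCont_tendsto_compose[OF cont]) (auto intro!: tendsto_eq_intros)
    then show ?thesis by simp
  qed
  from filterlim_compose[OF this filterlim_iterated_square[OF q]]
  have "\<forall>\<^sub>F n in sequentially. nome_theta (- (q ^ 2 ^ n)) > 0"
    by (rule order_tendstoD) simp
  then obtain n where n: "nome_theta (- (q ^ 2 ^ n)) > 0"
    by (auto simp: eventually_sequentially)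
  have step: "nome_theta (- r) > 0" if "nome_theta (- (r\<^sup>2)) > 0" "r \<in> {0<..<1}" for r
  proof -
    have "nome_theta r * nome_theta (- r) > 0"
      using nome_theta_mult_minus[of r] that by simp
    then show ?thesis using nome_theta_ge_1[of r] that by (auto simp: zero_less_mult_iff)
  qed
  show ?thesis using n
  proof (induction n)
    case (Suc n)
    have "q ^ 2 ^ n \<in> {0<..<1}" using q by (auto simp: power_less_one_iff)
    then show ?case using Suc step[of "q ^ 2 ^ n"] by (simp add: power_mult[symmetric] mult_ac)
  qed simp
qed

lemma nome_theta_pos: "\<bar>q\<bar> < 1 \<Longrightarrow> nome_theta q > 0"
  using nome_theta_ge_1[of q] nome_theta_minus_pos[of "- q"] by (cases "q \<ge> 0") auto

lemma nome_theta_minus_less: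
  assumes "q \<in> {0<..<1}"
  shows "nome_theta (- q) < nome_theta q"
proof -
  have s: "summable (\<lambda>n. q ^ ((Suc n)\<^sup>2))" using assms by (intro summable_square_powers) auto
  have s': "summable (\<lambda>n. (- q) ^ ((Suc n)\<^sup>2))"
    by (rule summable_norm_cancel) (use s assms in \<open>simp add: power_abs\<close>)
  have "0 < (\<Sum>n. q ^ ((Suc n)\<^sup>2) - (- q) ^ ((Suc n)\<^sup>2))"
  proof (rule suminf_pos2[where i = 0])
    show "summable (\<lambda>n. q ^ ((Suc n)\<^sup>2) - (- q) ^ ((Suc n)\<^sup>2))" by (intro summable_diff s s')
    show "0 \<le> q ^ ((Suc n)\<^sup>2) - (- q) ^ ((Suc n)\<^sup>2)" for n
      using assms by (subst power_minus) (simp add: minus_one_power_iff)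
  qed (use assms in simp)
  also have "\<dots> = (\<Sum>n. q ^ ((Suc n)\<^sup>2)) - (\<Sum>n. (- q) ^ ((Suc n)\<^sup>2))"
    by (rule suminf_diff[OF s s', symmetric])
  finally show ?thesis
    using nome_theta_has_sum(3)[of q] nome_theta_has_sum(3)[of "- q"] assms by simp
qed

lemma power4_eq_square_square: "(a :: 'a :: monoid_mult) ^ 4 = (a\<^sup>2)\<^sup>2"
  by (simp flip: power_mult)

section \<open>Logarithmic derivative in the nome and its behaviour under doubling\<close>

definition nome_logderiv :: "real \<Rightarrow> real" where
  "nome_logderiv q = nome_theta' q / nome_theta q"

definition nome_logderiv' :: "real \<Rightarrow> real" where
  "nome_logderiv' q = nome_theta'' q / nome_theta q - (nome_logderiv q)\<^sup>2"

lemma nome_theta_has_derivative: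
  assumes "\<bar>q\<bar> < 1"
  shows "(nome_theta has_field_derivative nome_theta q * nome_logderiv q) (at q)"
  using nome_theta_derivs(1)[OF assms] nome_theta_pos[OF assms] by (simp add: nome_logderiv_def)

lemma nome_logderiv_has_derivative:
  assumes "\<bar>q\<bar> < 1"
  shows "(nome_logderiv has_field_derivative nome_logderiv' q) (at q)"
  using nome_theta_pos[OF assms] unfolding nome_logderiv_def[abs_def] nome_logderiv'_def
  by (auto intro!: derivative_eq_intros nome_theta_derivs assms simp: field_simps power2_eq_square)

lemma isCont_nome_logderiv': "\<bar>q\<bar> < 1 \<Longrightarrow> isCont nome_logderiv' q"
  unfolding nome_logderiv'_def[abs_def]
  using nome_theta_pos[of q] DERIV_isCont[OF nome_theta_has_derivative, of q]
    DERIV_isCont[OF nome_logderiv_has_derivative, of q] nome_theta_derivs(3)[of q]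
  by (intro continuous_intros) auto

lemma nome_theta_chain [derivative_intros]:
  assumes "(g has_field_derivative g') (at x)" "\<bar>g x\<bar> < 1"
  shows "((\<lambda>x. nome_theta (g x)) has_field_derivative nome_theta (g x) * nome_logderiv (g x) * g') (at x)"
  by (rule DERIV_chain2[OF nome_theta_has_derivative assms(1)]) (rule assms)

lemma nome_logderiv_chain [derivative_intros]:
  assumes "(g has_field_derivative g') (at x)" "\<bar>g x\<bar> < 1"
  shows "((\<lambda>x. nome_logderiv (g x)) has_field_derivative nome_logderiv' (g x) * g') (at x)"
  by (rule DERIV_chain2[OF nome_logderiv_has_derivative assms(1)]) (rule assms)

lemma tendsto_nome_theta_at_0:
  shows "(nome_theta \<longlongrightarrow> 1) (at_right 0)" "((\<lambda>q. nome_theta (- q)) \<longlongrightarrow> 1) (at_right 0)"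
    and "((\<lambda>q. (nome_theta q ^ 4 - nome_theta (- q) ^ 4) / q) \<longlongrightarrow> 16) (at_right 0)"
proof -
  have "isCont nome_theta 0" using nome_theta_derivs(1)[of 0] by (intro DERIV_isCont) simp
  then show "(nome_theta \<longlongrightarrow> 1) (at_right 0)"
    unfolding isCont_def by (intro tendsto_mono[OF at_le, of "{0<..}" UNIV]) auto
  have "isCont (\<lambda>q. nome_theta (- q)) 0"
    by (rule DERIV_isCont) (auto intro!: derivative_eq_intros)
  then show "((\<lambda>q. nome_theta (- q)) \<longlongrightarrow> 1) (at_right 0)"
    unfolding isCont_def by (intro tendsto_mono[OF at_le, of "{0<..}" UNIV]) auto
  let ?f = "\<lambda>q. nome_theta q ^ 4 - nome_theta (- q) ^ 4"
  \<comment> \<open>The fourth powers at \<open>q\<close> and \<open>- q\<close> have derivatives 8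
    and -8 at 0, because theta has value 1 and derivative 2 there.\<close>
  have "(?f has_field_derivative 16) (at 0)"
    by (auto intro!: derivative_eq_intros simp: nome_logderiv_def)
  then have "((\<lambda>q. ?f q / q) \<longlongrightarrow> 16) (at 0)"
    by (simp add: has_field_derivative_iff)
  then show "((\<lambda>q. ?f q / q) \<longlongrightarrow> 16) (at_right 0)"
    by (rule tendsto_mono[OF at_le, rotated]) simp
qed

text \<open>Allows the doubling identities, valid on all of (-1, 1), to be differentiated.\<close>

lemma DERIV_unique_on_interval:
  fixes f g :: "real \<Rightarrow> real"
  assumes "(f has_field_derivative a) (at x)" "(g has_field_derivative b) (at x)"
    and "\<And>y. \<bar>y\<bar> < 1 \<Longrightarrow> f y = g y" and "\<bar>x\<bar> < 1"
  shows "a = b"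
proof -
  have "\<forall>\<^sub>F y in nhds x. y \<in> {-1<..<1::real}"
    using assms(4) by (intro eventually_nhds_in_open) auto
  then have "\<forall>\<^sub>F y in nhds x. f y = g y"
    by eventually_elim (use assms(3) in auto)
  then show ?thesis
    using assms(1,2) DERIV_cong_ev DERIV_unique by metis
qed

text \<open>Logarithmic differentiation of the geometric mean identity
  \<open>nome_theta_mult_minus\<close>.\<close>

lemma nome_logderiv_diff:
  assumes q: "\<bar>q\<bar> < 1"
  shows "nome_logderiv q - nome_logderiv (- q) = - 4 * q * nome_logderiv (- (q\<^sup>2))"
proof -
  have q2: "\<bar>q\<^sup>2\<bar> < 1" using q by (simp add: abs_square_less_1)
  let ?a = "nome_theta q" and ?b = "nome_theta (- q)" and ?c = "nome_theta (- (q\<^sup>2))"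
  have "?a * nome_logderiv q * ?b - ?a * (?b * nome_logderiv (- q))
    = 2 * ?c * (?c * nome_logderiv (- (q\<^sup>2)) * (- (2 * q)))"
    by (rule DERIV_unique_on_interval[of "\<lambda>q. nome_theta q * nome_theta (- q)" _ q
          "\<lambda>q. (nome_theta (- (q\<^sup>2)))\<^sup>2"])
      (use q q2 in \<open>auto intro!: derivative_eq_intros simp: nome_theta_mult_minus simp flip: power2_eq_square\<close>)
  then have "(?a * ?b) * (nome_logderiv q - nome_logderiv (- q)) = ?c\<^sup>2 * (- 4 * q * nome_logderiv (- (q\<^sup>2)))"
    by (simp add: algebra_simps power2_eq_square)
  moreover have "?a * ?b = ?c\<^sup>2" "?c > 0"
    using nome_theta_mult_minus[OF q] nome_theta_pos[of "- (q\<^sup>2)"] q2 by auto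
  ultimately have "?c\<^sup>2 * (nome_logderiv q - nome_logderiv (- q)) = ?c\<^sup>2 * (- 4 * q * nome_logderiv (- (q\<^sup>2)))"
    by (simp only:)
  then show ?thesis using \<open>?c > 0\<close> by (subst (asm) mult_left_cancel) auto
qed

text \<open>Derivative of the arithmetic mean identity \<open>nome_theta_square_add\<close>.\<close>

lemma nome_logderiv_square:
  assumes q: "\<bar>q\<bar> < 1"
  shows "(nome_theta q)\<^sup>2 * nome_logderiv q - (nome_theta (- q))\<^sup>2 * nome_logderiv (- q)
    = 4 * q * (nome_theta (q\<^sup>2))\<^sup>2 * nome_logderiv (q\<^sup>2)"
proof -
  have q2: "\<bar>q\<^sup>2\<bar> < 1" using q by (simp add: abs_square_less_1)
  have "2 * nome_theta q * (nome_theta q * nome_logderiv q)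
      - 2 * nome_theta (- q) * (nome_theta (- q) * nome_logderiv (- q))
    = 2 * (2 * nome_theta (q\<^sup>2) * (nome_theta (q\<^sup>2) * nome_logderiv (q\<^sup>2) * (2 * q)))"
    by (rule DERIV_unique_on_interval[of "\<lambda>q. (nome_theta q)\<^sup>2 + (nome_theta (- q))\<^sup>2" _ q
          "\<lambda>q. 2 * (nome_theta (q\<^sup>2))\<^sup>2"])
      (use q q2 in \<open>auto intro!: derivative_eq_intros nome_theta_square_add\<close>)
  then show ?thesis by (simp add: algebra_simps power2_eq_square)
qed

context
  fixes q x y :: real
  assumes q: "q \<in> {0<..<1}"
  defines "x \<equiv> (nome_theta q)\<^sup>2" and "y \<equiv> (nome_theta (- q))\<^sup>2"
begin

text \<open>In the coordinates \<open>x\<close> and \<open>y\<close> doubling the nome is one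
  arithmetic-geometric mean step; the geometric mean is kept squared, so that no root
  appears.\<close>

lemma nome_squares: "0 < y" "y < x"
  and nome_square_doubling: "(nome_theta (q\<^sup>2))\<^sup>2 = (x + y) / 2" "(nome_theta (- (q\<^sup>2))) ^ 4 = x * y"
proof -
  have "nome_theta (- q) > 0" "nome_theta (- q) < nome_theta q"
    using nome_theta_pos[of "- q"] nome_theta_minus_less[OF q] q by auto
  then show "0 < y" "y < x"
    by (auto simp: x_def y_def intro!: power_strict_mono)
  show "(nome_theta (q\<^sup>2))\<^sup>2 = (x + y) / 2"
    using nome_theta_square_add[of q] q by (simp add: x_def y_def)
  have "(nome_theta (- (q\<^sup>2))) ^ 4 = ((nome_theta (- (q\<^sup>2)))\<^sup>2)\<^sup>2" by simp
  also have "(nome_theta (- (q\<^sup>2)))\<^sup>2 = nome_theta q * nome_theta (- q)"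
    using nome_theta_mult_minus[of q] q by simp
  finally show "(nome_theta (- (q\<^sup>2))) ^ 4 = x * y"
    by (simp add: x_def y_def power_mult_distrib)
qed

lemma nome_logderiv_doubling:
  "4 * q * nome_logderiv (- (q\<^sup>2)) = nome_logderiv (- q) - nome_logderiv q"
  "2 * q * (x + y) * nome_logderiv (q\<^sup>2) = x * nome_logderiv q - y * nome_logderiv (- q)"
  using nome_logderiv_diff[of q] nome_logderiv_square[of q] nome_square_doubling q
  by (auto simp: x_def y_def)

end

text \<open>Under \<open>q\<close> to \<open>q^2\<close> the sum of logarithmic derivatives times
  \<open>q\<close> and the difference of fourth powers are both multiplied by (x - y) / (4 (x + y)).
  Their quotient is therefore invariant, and its limit at 0 is 4 / 16.\<close>

lemma nome_logderiv_add:
  assumes q: "q \<in> {0<..<1}"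
  shows "4 * q * (nome_logderiv q + nome_logderiv (- q)) = nome_theta q ^ 4 - nome_theta (- q) ^ 4"
proof -
  define h where "h q = q * (nome_logderiv q + nome_logderiv (- q)) / (nome_theta q ^ 4 - nome_theta (- q) ^ 4)" for q
  have "h (q\<^sup>2) = h q" if q: "q \<in> {0<..<1}" for q
  proof -
    define x y a b a1 b1 where defs: "x = (nome_theta q)\<^sup>2" "y = (nome_theta (- q))\<^sup>2"
      "a = nome_logderiv q" "b = nome_logderiv (- q)"
      "a1 = nome_logderiv (q\<^sup>2)" "b1 = nome_logderiv (- (q\<^sup>2))"
    note xy = nome_squares[OF q, folded defs]
    have x1: "nome_theta (q\<^sup>2) ^ 4 = ((x + y) / 2)\<^sup>2"
      using power4_eq_square_square nome_square_doubling(1)[OF q, folded defs] by metis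
    note dbl = nome_logderiv_doubling[OF q, folded defs]
    have "4 * (x + y) * (q\<^sup>2 * (a1 + b1)) = q * (2 * (2 * q * (x + y) * a1) + (x + y) * (4 * q * b1))"
      by (simp add: algebra_simps power2_eq_square)
    also have "\<dots> = q * ((x - y) * (a + b))"
      unfolding dbl by (simp add: algebra_simps)
    finally have num: "q\<^sup>2 * (a1 + b1) = q * (x - y) * (a + b) / (4 * (x + y))"
      using xy by (simp add: field_simps)
    have den: "nome_theta (q\<^sup>2) ^ 4 - nome_theta (- (q\<^sup>2)) ^ 4 = (x - y)\<^sup>2 / 4"
      unfolding x1 nome_square_doubling(2)[OF q, folded defs] by (simp add: field_simps power2_eq_square)
    have "h (q\<^sup>2) = (q * (x - y) * (a + b) / (4 * (x + y))) / ((x - y)\<^sup>2 / 4)"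
      unfolding h_def den defs(5,6)[symmetric] num ..
    also have "\<dots> = q * (a + b) / (x\<^sup>2 - y\<^sup>2)"
    proof -
      have "x\<^sup>2 - y\<^sup>2 = (x - y) * (x + y)" by (simp add: algebra_simps power2_eq_square)
      then show ?thesis using xy by (simp add: divide_simps power2_eq_square) (simp add: algebra_simps)
    qed
    also have "\<dots> = h q" by (simp add: h_def defs)
    finally show ?thesis .
  qed
  moreover have "(h \<longlongrightarrow> 1 / 4) (at_right 0)"
  proof -
    let ?f = "\<lambda>q. nome_theta q ^ 4 - nome_theta (- q) ^ 4"
    have l0: "nome_logderiv 0 = 2" by (simp add: nome_logderiv_def)
    have "isCont (\<lambda>q. nome_logderiv q + nome_logderiv (- q)) 0"
      by (rule DERIV_isCont) (auto intro!: derivative_eq_intros)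
    then have "((\<lambda>q. nome_logderiv q + nome_logderiv (- q)) \<longlongrightarrow> 4) (at_right 0)"
      using l0 unfolding isCont_def by (intro tendsto_mono[OF at_le, of "{0<..}" UNIV]) auto
    from tendsto_divide[OF this tendsto_nome_theta_at_0(3)]
    have "((\<lambda>q. (nome_logderiv q + nome_logderiv (- q)) / (?f q / q)) \<longlongrightarrow> 1 / 4) (at_right 0)"
      by simp
    also have "(\<lambda>q. (nome_logderiv q + nome_logderiv (- q)) / (?f q / q)) = h"
      by (auto simp: h_def fun_eq_iff)
    finally show ?thesis .
  qed
  ultimately have "h q = 1 / 4" using q by (rule squaring_invariant_unique)
  moreover have "nome_theta q ^ 4 - nome_theta (- q) ^ 4 > 0"
    using nome_theta_minus_less[OF q] nome_theta_pos[of "- q"] q by (auto intro!: power_strict_mono)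
  ultimately show ?thesis by (simp add: h_def field_simps)
qed

text \<open>Eliminating the value at \<open>- q\<close> with \<open>nome_logderiv_add\<close> leaves
  a recurrence for \<open>q * nome_logderiv q\<close> alone, which can be differentiated once
  more.\<close>

lemma nome_logderiv_square_arg:
  assumes q: "q \<in> {0<..<1}"
  shows "q\<^sup>2 * nome_logderiv (q\<^sup>2) =
    q * nome_logderiv q / 2 - (nome_theta (- q))\<^sup>2 * ((nome_theta q)\<^sup>2 - (nome_theta (- q))\<^sup>2) / 8"
proof -
  define x y a b a1 where defs: "x = (nome_theta q)\<^sup>2" "y = (nome_theta (- q))\<^sup>2"
    "a = nome_logderiv q" "b = nome_logderiv (- q)" "a1 = nome_logderiv (q\<^sup>2)"
  note xy = nome_squares[OF q, folded defs]
  have "4 * q * (a + b) = nome_theta q ^ 4 - nome_theta (- q) ^ 4"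
    using nome_logderiv_add[OF q] by (simp add: defs)
  also have "\<dots> = x\<^sup>2 - y\<^sup>2" by (simp add: defs)
  finally have b: "q * b = (x\<^sup>2 - y\<^sup>2) / 4 - q * a" by (simp add: algebra_simps)
  have "2 * (x + y) * (q\<^sup>2 * a1) = q * (2 * q * (x + y) * a1)"
    by (simp add: power2_eq_square)
  also have "\<dots> = x * (q * a) - y * (q * b)"
    unfolding nome_logderiv_doubling(2)[OF q, folded defs] by (simp add: algebra_simps)
  also have "\<dots> = 2 * (x + y) * (q * a / 2 - y * (x - y) / 8)"
    unfolding b by (simp add: field_simps power2_eq_square)
  finally have "q\<^sup>2 * a1 = q * a / 2 - y * (x - y) / 8"
    using xy by simp
  then show ?thesis by (simp only: defs)
qed

text \<open>The defect below is multiplied by \<open>1/4\<close> under \<open>q \<mapsto> q\<^sup>2\<close>, but \<open>q\<close> itself decreases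
  superexponentially under this iteration, so the defect, being \<open>O(q)\<close>, must vanish.\<close>

lemma nome_logderiv'_eq:
  assumes q: "q \<in> {0<..<1}"
  shows "2 * q * (nome_logderiv q + q * nome_logderiv' q) - 4 * (q * nome_logderiv q)\<^sup>2
    = (nome_theta q ^ 4 - nome_theta (- q) ^ 4) * nome_theta (- q) ^ 4 / 4"
proof -
  define E where "E q = 2 * q * (nome_logderiv q + q * nome_logderiv' q) - 4 * (q * nome_logderiv q)\<^sup>2
    - (nome_theta q ^ 4 - nome_theta (- q) ^ 4) * nome_theta (- q) ^ 4 / 4" for q
  have rec: "E (q\<^sup>2) = 1 / 4 * E q" if q: "q \<in> {0<..<1}" for q
  proof -
    define x y a a' a1 a1' where defs: "x = (nome_theta q)\<^sup>2" "y = (nome_theta (- q))\<^sup>2"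
      "a = nome_logderiv q" "a' = nome_logderiv' q"
      "a1 = nome_logderiv (q\<^sup>2)" "a1' = nome_logderiv' (q\<^sup>2)"
    define b where "b = nome_logderiv (- q)"
    have x4: "nome_theta q ^ 4 = x\<^sup>2" and y4: "nome_theta (- q) ^ 4 = y\<^sup>2"
      by (simp_all add: defs)
    have x1: "nome_theta (q\<^sup>2) ^ 4 = ((x + y) / 2)\<^sup>2"
      using power4_eq_square_square nome_square_doubling(1)[OF q, folded defs] by metis
    have "4 * q * (a + b) = x\<^sup>2 - y\<^sup>2"
      using nome_logderiv_add[OF q] by (simp add: defs b_def)
    then have b: "q * b = (x\<^sup>2 - y\<^sup>2) / 4 - q * a" by (simp add: algebra_simps)
    have a1: "q\<^sup>2 * a1 = q * a / 2 - y * (x - y) / 8"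
      using nome_logderiv_square_arg[OF q] by (simp only: defs)
    have q2: "\<bar>q\<^sup>2\<bar> < 1" using q by (simp add: abs_square_less_1)
    have d1: "((\<lambda>q. q\<^sup>2 * nome_logderiv (q\<^sup>2)) has_field_derivative
        2 * q * a1 + q\<^sup>2 * (a1' * (2 * q))) (at q)"
      using q2 by (auto intro!: derivative_eq_intros simp: defs)
    have d2: "((\<lambda>q. q * nome_logderiv q / 2 - (nome_theta (- q))\<^sup>2 * ((nome_theta q)\<^sup>2 - (nome_theta (- q))\<^sup>2) / 8)
        has_field_derivative ((a + q * a') / 2 - (- 2 * y * b * (x - y) + y * (2 * x * a + 2 * y * b)) / 8)) (at q)"
      using q by (auto intro!: derivative_eq_intros simp: defs b_def power2_eq_square field_simps)
    \<comment> \<open>The recurrence holds on a neighbourhood of \<open>q\<close>, so the two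
      derivatives coincide; this expresses \<open>a1'\<close> through quantities at
      \<open>q\<close>.\<close>
    have "\<forall>\<^sub>F r in nhds q. r \<in> {0<..<1}" using q by (intro eventually_nhds_in_open) auto
    then have "\<forall>\<^sub>F r in nhds q. r\<^sup>2 * nome_logderiv (r\<^sup>2) =
      r * nome_logderiv r / 2 - (nome_theta (- r))\<^sup>2 * ((nome_theta r)\<^sup>2 - (nome_theta (- r))\<^sup>2) / 8"
      by eventually_elim (rule nome_logderiv_square_arg)
    from DERIV_unique[OF d1[unfolded DERIV_cong_ev[OF refl this refl]] d2]
    have d: "2 * q * a1 + q\<^sup>2 * (a1' * (2 * q)) =
      (a + q * a') / 2 - (- 2 * y * b * (x - y) + y * (2 * x * a + 2 * y * b)) / 8" .
    have "2 * (q\<^sup>2 * (a1 + q\<^sup>2 * a1')) = q * (2 * q * a1 + q\<^sup>2 * (a1' * (2 * q)))"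
      by (simp add: algebra_simps power2_eq_square)
    also have "\<dots> = (q * a + q\<^sup>2 * a') / 2 - (- 2 * y * (q * b) * (x - y) + y * (2 * x * (q * a) + 2 * y * (q * b))) / 8"
      unfolding d by (simp add: field_simps power2_eq_square)
    finally have e: "2 * (q\<^sup>2 * (a1 + q\<^sup>2 * a1')) = \<dots>" .
    have "E (q\<^sup>2) = 2 * (q\<^sup>2 * (a1 + q\<^sup>2 * a1')) - 4 * (q\<^sup>2 * a1)\<^sup>2 - (((x + y) / 2)\<^sup>2 - x * y) * (x * y) / 4"
      unfolding E_def x1 nome_square_doubling(2)[OF q, folded defs] defs by simp
    also have "\<dots> = 1 / 4 * (2 * (q * a + q\<^sup>2 * a') - 4 * (q * a)\<^sup>2 - (x\<^sup>2 - y\<^sup>2) * y\<^sup>2 / 4)"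
      unfolding e b a1 by (simp add: field_simps power2_eq_square)
    also have "\<dots> = 1 / 4 * E q"
      unfolding E_def x4 y4 defs by (simp add: algebra_simps power2_eq_square)
    finally show ?thesis .
  qed
  \<comment> \<open>\<open>G\<close> is the defect with one factor \<open>q\<close> removed: by
    \<open>nome_logderiv_add\<close> the difference of fourth powers is itself a multiple of
    \<open>q\<close>. In this form it is continuous at 0.\<close>
  define G where "G q = 2 * (nome_logderiv q + q * nome_logderiv' q) - 4 * q * (nome_logderiv q)\<^sup>2
    - (nome_logderiv q + nome_logderiv (- q)) * nome_theta (- q) ^ 4" for q
  have E_G: "E q = q * G q" if "q \<in> {0<..<1}" for q
    unfolding E_def G_def nome_logderiv_add[OF that, symmetric]
    by (simp add: algebra_simps power2_eq_square)
  have "isCont G 0"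
  proof -
    have "isCont (\<lambda>q. nome_logderiv (- q)) 0" "isCont (\<lambda>q. nome_theta (- q)) 0"
      "isCont nome_logderiv 0"
      by (rule DERIV_isCont, auto intro!: derivative_eq_intros nome_logderiv_has_derivative)+
    then show ?thesis unfolding G_def by (intro continuous_intros isCont_nome_logderiv') auto
  qed
  then have "(G \<longlongrightarrow> G 0) (at_right 0)"
    unfolding isCont_def by (intro tendsto_mono[OF at_le, of "{0<..}" UNIV]) auto
  from filterlim_compose[OF this filterlim_iterated_square[OF q]]
  have "(\<lambda>n. G (q ^ 2 ^ n)) \<longlonglongrightarrow> G 0" .
  moreover have "(\<lambda>n. 4 ^ n * q ^ 2 ^ n) \<longlonglongrightarrow> 0"
  proof -
    \<comment> \<open>The square of this sequence is m^2 q^m, and the subsequence m = 2^n is the one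
      wanted.\<close>
    have "(\<lambda>m. real m * sqrt q ^ m) \<longlonglongrightarrow> 0"
      using q by (intro powser_times_n_limit_0) auto
    then have "(\<lambda>m. (real m * sqrt q ^ m)\<^sup>2) \<longlonglongrightarrow> 0\<^sup>2"
      by (intro tendsto_power)
    moreover have "(real m * sqrt q ^ m)\<^sup>2 = (real m)\<^sup>2 * q ^ m" for m
      using q by (simp add: power_mult_distrib flip: real_sqrt_power)
    ultimately have "(\<lambda>m. (real m)\<^sup>2 * q ^ m) \<longlonglongrightarrow> 0" by simp
    moreover have "strict_mono (\<lambda>n. 2 ^ n :: nat)" by (intro strict_monoI) simp
    ultimately have "((\<lambda>m. (real m)\<^sup>2 * q ^ m) \<circ> (\<lambda>n. 2 ^ n)) \<longlonglongrightarrow> 0"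
      by (rule LIMSEQ_subseq_LIMSEQ)
    moreover have "(real (2 ^ n))\<^sup>2 = 4 ^ n" for n :: nat
      by (simp add: power2_eq_square flip: power_mult_distrib)
    ultimately show ?thesis by (simp add: o_def)
  qed
  ultimately have "(\<lambda>n. 4 ^ n * q ^ 2 ^ n * G (q ^ 2 ^ n)) \<longlonglongrightarrow> 0"
    by (metis (mono_tags) tendsto_mult mult_zero_left)
  moreover have "4 ^ n * q ^ 2 ^ n * G (q ^ 2 ^ n) = E q" for n
  proof -
    have "q ^ 2 ^ n \<in> {0<..<1}" using q by (auto simp: power_less_one_iff)
    then have "4 ^ n * q ^ 2 ^ n * G (q ^ 2 ^ n) = 4 ^ n * E (q ^ 2 ^ n)"
      by (simp add: E_G)
    also have "E (q ^ 2 ^ n) = (1 / 4) ^ n * E q"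
      by (rule squaring_recurrence_iterate[of E, OF rec q])
    also have "4 ^ n * ((1 / 4) ^ n * E q) = E q"
      by (simp add: power_divide)
    finally show ?thesis .
  qed
  ultimately have "E q = 0" by (simp add: LIMSEQ_const_iff)
  then show ?thesis by (simp add: E_def)
qed

section \<open>Gauss's elliptic integral\<close>

definition agm_integral :: "real \<Rightarrow> real \<Rightarrow> real" where
  "agm_integral a b = integral {0..pi/2} (\<lambda>\<phi>. 1 / sqrt (a\<^sup>2 * (cos \<phi>)\<^sup>2 + b\<^sup>2 * (sin \<phi>)\<^sup>2))"

lemma agm_quadratic_pos:
  fixes a b :: real
  assumes "a > 0" "b > 0"
  shows "a\<^sup>2 * (cos x)\<^sup>2 + b\<^sup>2 * (sin x)\<^sup>2 > 0"
proof (cases "cos x = 0")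
  case True
  then have "sin x \<noteq> 0" using sin_zero_abs_cos_one by fastforce
  then show ?thesis using assms True by simp
qed (use assms in \<open>auto intro!: add_pos_nonneg\<close>)

lemma continuous_on_agm_integrand:
  fixes a b :: real
  assumes "a > 0" "b > 0"
  shows "continuous_on S (\<lambda>\<phi>. 1 / sqrt (a\<^sup>2 * (cos \<phi>)\<^sup>2 + b\<^sup>2 * (sin \<phi>)\<^sup>2))"
proof -
  have "sqrt (a\<^sup>2 * (cos x)\<^sup>2 + b\<^sup>2 * (sin x)\<^sup>2) \<noteq> 0" for x
    using real_sqrt_gt_zero[OF agm_quadratic_pos[OF assms, of x]] by (rule less_imp_neq[THEN not_sym])
  then show ?thesis by (intro continuous_intros) blast
qed

lemma agm_integrand_integrable:
  fixes a b :: real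
  assumes "a > 0" "b > 0"
  shows "(\<lambda>\<phi>. 1 / sqrt (a\<^sup>2 * (cos \<phi>)\<^sup>2 + b\<^sup>2 * (sin \<phi>)\<^sup>2)) integrable_on {u..v}"
  by (intro integrable_continuous_interval continuous_on_agm_integrand assms)

lemma agm_integral_commute: "agm_integral a b = agm_integral b a"
proof -
  let ?f = "\<lambda>\<phi>. 1 / sqrt (a\<^sup>2 * (cos \<phi>)\<^sup>2 + b\<^sup>2 * (sin \<phi>)\<^sup>2)"
  have "integral {0..pi/2} ?f = integral {-(pi/2)..0} (\<lambda>x. ?f (- x))"
    by (simp only: Henstock_Kurzweil_Integration.integral_reflect_real[of "pi/2" 0 ?f, symmetric, unfolded minus_zero])
  also have "\<dots> = integral {-(pi/2)..0} ?f"
    by (simp only: cos_minus sin_minus power2_minus)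
  also have "\<dots> = integral {0..pi/2} (?f \<circ> ((+) (- (pi/2))))"
    by (simp only: integral_shift_Icc_real) simp
  also have "\<dots> = agm_integral b a"
    unfolding agm_integral_def by (simp add: o_def sin_diff cos_diff add.commute)
  finally show ?thesis by (simp add: agm_integral_def)
qed

lemma agm_integral_scale:
  assumes "r > 0"
  shows "agm_integral (r * a) (r * b) = agm_integral a b / r"
proof -
  have "1 / sqrt ((r * a)\<^sup>2 * (cos x)\<^sup>2 + (r * b)\<^sup>2 * (sin x)\<^sup>2) = inverse r * (1 / sqrt (a\<^sup>2 * (cos x)\<^sup>2 + b\<^sup>2 * (sin x)\<^sup>2))" for x
  proof -
    have "(r * a)\<^sup>2 * (cos x)\<^sup>2 + (r * b)\<^sup>2 * (sin x)\<^sup>2 = r\<^sup>2 * (a\<^sup>2 * (cos x)\<^sup>2 + b\<^sup>2 * (sin x)\<^sup>2)"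
      by (simp only: power_mult_distrib distrib_left mult.assoc)
    then have "sqrt ((r * a)\<^sup>2 * (cos x)\<^sup>2 + (r * b)\<^sup>2 * (sin x)\<^sup>2) = r * sqrt (a\<^sup>2 * (cos x)\<^sup>2 + b\<^sup>2 * (sin x)\<^sup>2)"
      using assms by (simp only: real_sqrt_mult real_sqrt_abs abs_of_pos)
    then show ?thesis by (simp only: divide_inverse inverse_mult_distrib mult_1)
  qed
  then show ?thesis unfolding agm_integral_def
    by (simp only: Henstock_Kurzweil_Integration.integral_mult_right divide_inverse[of _ r] mult.commute[of _ "inverse r"])
qed

text \<open>Lets the modulus be recovered from the integral, as the inversion argument
  requires.\<close>

lemma agm_integral_strict_antimono:
  assumes "a > 0" "0 < b" "b < c"
  shows "agm_integral a c < agm_integral a b"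
  unfolding agm_integral_def
proof (rule integral_less_real)
  fix x assume x: "x \<in> {0<..<pi/2}"
  then have "sin x > 0" by (intro sin_gt_zero) auto
  then have "a\<^sup>2 * (cos x)\<^sup>2 + b\<^sup>2 * (sin x)\<^sup>2 < a\<^sup>2 * (cos x)\<^sup>2 + c\<^sup>2 * (sin x)\<^sup>2"
    using assms by (intro add_strict_left_mono mult_strict_right_mono power_strict_mono) auto
  then show "1 / sqrt (a\<^sup>2 * (cos x)\<^sup>2 + c\<^sup>2 * (sin x)\<^sup>2) < 1 / sqrt (a\<^sup>2 * (cos x)\<^sup>2 + b\<^sup>2 * (sin x)\<^sup>2)"
    using agm_quadratic_pos[of a b x] assms by (intro divide_strict_left_mono mult_pos_pos) auto
qed (use assms pi_gt_zero in \<open>auto intro!: continuous_on_agm_integrand simp del: pi_gt_zero\<close>)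

text \<open>The quadratic form under the root lies between \<open>b^2\<close> and
  \<open>a^2\<close>; this squeezes the integral when both arguments tend to 1.\<close>

lemma agm_integral_bounds:
  assumes "0 < b" "b \<le> a"
  shows "pi / (2 * a) \<le> agm_integral a b" "agm_integral a b \<le> pi / (2 * b)"
proof -
  have eq: "r\<^sup>2 = r\<^sup>2 * (cos x)\<^sup>2 + r\<^sup>2 * (sin x)\<^sup>2" for r x :: real
    by (simp flip: distrib_left)
  have const: "integral {0..pi/2} (\<lambda>\<phi>. 1 / r) = pi / (2 * r)" for r :: real
    by simp
  have "integral {0..pi/2} (\<lambda>\<phi>. 1 / a) \<le> agm_integral a b"
    unfolding agm_integral_def
  proof (intro integral_le agm_integrand_integrable)
    fix x
    have "a\<^sup>2 * (cos x)\<^sup>2 + b\<^sup>2 * (sin x)\<^sup>2 \<le> a\<^sup>2"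
      using assms by (subst (2) eq[of a x]) (auto intro!: mult_right_mono power_mono)
    then have "sqrt (a\<^sup>2 * (cos x)\<^sup>2 + b\<^sup>2 * (sin x)\<^sup>2) \<le> a"
      using assms by (intro real_le_lsqrt) auto
    then show "1 / a \<le> 1 / sqrt (a\<^sup>2 * (cos x)\<^sup>2 + b\<^sup>2 * (sin x)\<^sup>2)"
      using agm_quadratic_pos[of a b x] assms by (intro divide_left_mono mult_pos_pos) auto
  qed (use assms in auto)
  then show "pi / (2 * a) \<le> agm_integral a b" unfolding const .
  have "agm_integral a b \<le> integral {0..pi/2} (\<lambda>\<phi>. 1 / b)"
    unfolding agm_integral_def
  proof (intro integral_le agm_integrand_integrable)
    fix x
    have "b\<^sup>2 \<le> a\<^sup>2 * (cos x)\<^sup>2 + b\<^sup>2 * (sin x)\<^sup>2"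
      using assms by (subst (1) eq[of b x]) (auto intro!: mult_right_mono power_mono)
    then have "b \<le> sqrt (a\<^sup>2 * (cos x)\<^sup>2 + b\<^sup>2 * (sin x)\<^sup>2)"
      using assms by (intro real_le_rsqrt) auto
    then show "1 / sqrt (a\<^sup>2 * (cos x)\<^sup>2 + b\<^sup>2 * (sin x)\<^sup>2) \<le> 1 / b"
      using agm_quadratic_pos[of a b x] assms by (intro divide_left_mono mult_pos_pos) auto
  qed (use assms in auto)
  then show "agm_integral a b \<le> pi / (2 * b)" unfolding const .
qed

text \<open>Gauss's substitution: if \<open>u = b tan \<theta>\<close>, then \<open>(u - a b / u) / 2 = sqrt (a b) tan \<phi>\<close>.\<close>

lemma agm_integral_gauss:
  assumes a: "a > 0" and b: "b > 0"
  shows "agm_integral ((a + b) / 2) (sqrt (a * b)) = agm_integral a b"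
proof -
  define a1 b1 where "a1 = (a + b) / 2" and "b1 = sqrt (a * b)"
  have a1: "a1 > 0" and b1: "b1 > 0" and b1sq: "b1\<^sup>2 = a * b" using a b by (auto simp: a1_def b1_def)
  define f where "f = (\<lambda>\<phi>. 1 / sqrt (a1\<^sup>2 * (cos \<phi>)\<^sup>2 + b1\<^sup>2 * (sin \<phi>)\<^sup>2))"
  \<comment> \<open>\<open>w\<close> is (u - a b / u) / 2 for u = b tan x, and \<open>g\<close> is
    the new angle. It carries (0, pi/2) onto all of (-pi/2, pi/2), twice the original length; this
    accounts for the factor 2 on both sides below.\<close>
  define w where "w = (\<lambda>x. (b * tan x - a / tan x) / 2)"
  define w' where "w' = (\<lambda>x. (b / (cos x)\<^sup>2 + a / (sin x)\<^sup>2) / 2)"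
  define g where "g = (\<lambda>x. arctan (w x / b1))"
  define g' where "g' = (\<lambda>x. b1 * w' x / (b1\<^sup>2 + (w x)\<^sup>2))"
  define S where "S = {0<..<pi/2}"
  have sc: "sin x > 0" "cos x > 0" "tan x > 0" if "x \<in> S" for x
    using that by (auto simp: S_def intro!: sin_gt_zero cos_gt_zero tan_gt_zero)
  have w: "(w has_field_derivative w' x) (at x)" if "x \<in> S" for x
  proof -
    have "(w has_field_derivative (b * inverse ((cos x)\<^sup>2) + a * inverse ((cos x)\<^sup>2) / (tan x)\<^sup>2) / 2) (at x)"
      unfolding w_def using sc[OF that]
      by (auto intro!: derivative_eq_intros simp: power2_eq_square)
    also have "(b * inverse ((cos x)\<^sup>2) + a * inverse ((cos x)\<^sup>2) / (tan x)\<^sup>2) / 2 = w' x"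
      using sc[OF that] by (simp add: w'_def tan_def field_simps)
    finally show ?thesis .
  qed
  have g: "(g has_field_derivative g' x) (at x within S)" if "x \<in> S" for x
  proof -
    have "(g has_field_derivative inverse (1 + (w x / b1)\<^sup>2) * (w' x / b1)) (at x)"
      unfolding g_def by (rule DERIV_chain2[OF DERIV_arctan DERIV_cdivide[OF w[OF that]]])
    also have "inverse (1 + (w x / b1)\<^sup>2) * (w' x / b1) = g' x"
    proof -
      have "1 + (w x / b1)\<^sup>2 = (b1\<^sup>2 + (w x)\<^sup>2) / b1\<^sup>2" using b1 by (simp add: field_simps)
      then show ?thesis using b1 by (simp add: g'_def power2_eq_square)
    qed
    finally show ?thesis by (rule has_field_derivative_at_within)
  qed
  have w'_pos: "w' x > 0" if "x \<in> S" for x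
    using sc[OF that] a b by (auto simp: w'_def intro!: add_pos_pos)
  have mono: "w x < w y" if "x \<in> S" "y \<in> S" "x < y" for x y
  proof (rule DERIV_pos_imp_increasing[OF that(3)])
    fix z assume "x \<le> z" "z \<le> y"
    then have "z \<in> S" using that by (auto simp: S_def)
    then show "\<exists>d. (w has_field_derivative d) (at z) \<and> d > 0" using w w'_pos by blast
  qed
  have inj: "inj_on g S"
  proof (rule linorder_inj_onI')
    fix x y assume "x \<in> S" "y \<in> S" "x < y"
    then have "w x < w y" by (rule mono)
    then show "g x \<noteq> g y" using b1 by (auto simp: g_def arctan_eq_iff)
  qed
  have img: "g ` S = {-(pi/2)<..<pi/2}"
  proof (intro equalityI subsetI)
    fix y assume "y \<in> g ` S"
    then show "y \<in> {-(pi/2)<..<pi/2}" using arctan_bounded by (auto simp: g_def)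
  next
    fix y :: real assume y: "y \<in> {-(pi/2)<..<pi/2}"
    define v where "v = b1 * tan y"
    \<comment> \<open>The preimage comes from the positive root of u^2 - 2 u v - a b = 0, that is,
      of w = v rewritten in terms of u.\<close>
    define u where "u = v + sqrt (v\<^sup>2 + a * b)"
    have "\<bar>v\<bar> < sqrt (v\<^sup>2 + a * b)" using a b by (intro real_less_rsqrt) auto
    then have u: "u > 0" by (simp add: u_def)
    have "(u - v)\<^sup>2 = v\<^sup>2 + a * b" using a b by (simp add: u_def)
    then have uv: "u\<^sup>2 - a * b = 2 * u * v" by (simp add: power2_diff)
    define x where "x = arctan (u / b)"
    have x: "x \<in> S" using u b arctan_ubound by (auto simp: S_def x_def)
    have "w x = (u\<^sup>2 - a * b) / (2 * u)"
      using u b by (simp add: w_def x_def tan_arctan field_simps power2_eq_square)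
    also have "\<dots> = v" using u unfolding uv by simp
    finally have "g x = y" using y b1 by (simp add: g_def v_def arctan_tan)
    then show "y \<in> g ` S" using x by blast
  qed
  \<comment> \<open>With \<open>L\<close> and \<open>Q\<close> as below the Jacobian is 2 b1 / L and
    the transformed integrand L / (b1 sqrt Q), so \<open>L\<close> cancels.\<close>
  have fg: "\<bar>g' x\<bar> * f (g x) = 2 * (1 / sqrt (a\<^sup>2 * (cos x)\<^sup>2 + b\<^sup>2 * (sin x)\<^sup>2))" if x: "x \<in> S" for x
  proof -
    define s c W where "s = sin x" and "c = cos x" and "W = w x"
    have s: "s > 0" and c: "c > 0" using sc[OF x] by (auto simp: s_def c_def)
    have sc1: "s\<^sup>2 + c\<^sup>2 = 1" by (simp add: s_def c_def)
    define Q where "Q = a\<^sup>2 * c\<^sup>2 + b\<^sup>2 * s\<^sup>2"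
    have Q: "Q > 0" using agm_quadratic_pos[OF a b] by (simp add: Q_def s_def c_def)
    define L where "L = b * s\<^sup>2 + a * c\<^sup>2"
    have L: "L > 0" using a b s c by (simp add: L_def add_pos_pos)
    have W: "W = (b * s\<^sup>2 - a * c\<^sup>2) / (2 * s * c)"
      using s c by (simp add: W_def w_def tan_def s_def[symmetric] c_def[symmetric] field_simps power2_eq_square)
    have w': "w' x = L / (2 * s\<^sup>2 * c\<^sup>2)"
      using s c by (simp add: w'_def L_def s_def[symmetric] c_def[symmetric] field_simps)
    have bW: "b1\<^sup>2 + W\<^sup>2 = (L / (2 * s * c))\<^sup>2"
      using s c unfolding b1sq W L_def by (simp add: field_simps power2_eq_square)
    have aW: "a1\<^sup>2 + W\<^sup>2 = Q / (2 * s * c)\<^sup>2"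
    proof -
      have "(a1\<^sup>2 + W\<^sup>2) * (2 * s * c)\<^sup>2 = ((a + b) * s * c)\<^sup>2 + (b * s\<^sup>2 - a * c\<^sup>2)\<^sup>2"
        using s c unfolding W a1_def
        by (simp only: distrib_right[of "((a + b) / 2)\<^sup>2"]) (simp add: power_divide power_mult_distrib)
      also have "\<dots> = (s\<^sup>2 + c\<^sup>2) * Q"
        by (simp add: Q_def algebra_simps power2_eq_square)
      finally show ?thesis using s c unfolding sc1 by (simp add: field_simps)
    qed
    have cos: "(cos (g x))\<^sup>2 = b1\<^sup>2 / (b1\<^sup>2 + W\<^sup>2)" and sin: "(sin (g x))\<^sup>2 = W\<^sup>2 / (b1\<^sup>2 + W\<^sup>2)"
    proof -
      have *: "1 + (W / b1)\<^sup>2 = (b1\<^sup>2 + W\<^sup>2) / b1\<^sup>2" using b1 by (simp add: field_simps)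
      have p: "1 + (W / b1)\<^sup>2 > 0" by (intro add_pos_nonneg) auto
      show "(cos (g x))\<^sup>2 = b1\<^sup>2 / (b1\<^sup>2 + W\<^sup>2)"
        using p by (simp add: g_def cos_arctan W_def[symmetric] power_divide[of 1] *)
      have "(sin (g x))\<^sup>2 = (W / b1)\<^sup>2 / (sqrt (1 + (W / b1)\<^sup>2))\<^sup>2"
        by (simp only: g_def sin_arctan W_def power_divide)
      also have "(sqrt (1 + (W / b1)\<^sup>2))\<^sup>2 = (b1\<^sup>2 + W\<^sup>2) / b1\<^sup>2"
        using p * by simp
      also have "(W / b1)\<^sup>2 / \<dots> = W\<^sup>2 / (b1\<^sup>2 + W\<^sup>2)"
        using b1 by (simp add: power_divide)
      finally show "(sin (g x))\<^sup>2 = W\<^sup>2 / (b1\<^sup>2 + W\<^sup>2)" .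
    qed
    have bW0: "b1\<^sup>2 + W\<^sup>2 > 0" using b1 by (simp add: add_pos_nonneg)
    have "a1\<^sup>2 * (cos (g x))\<^sup>2 + b1\<^sup>2 * (sin (g x))\<^sup>2 = b1\<^sup>2 * ((a1\<^sup>2 + W\<^sup>2) / (b1\<^sup>2 + W\<^sup>2))"
      unfolding cos sin using bW0 by (simp add: add_divide_distrib algebra_simps)
    also have "(a1\<^sup>2 + W\<^sup>2) / (b1\<^sup>2 + W\<^sup>2) = Q / L\<^sup>2"
      unfolding aW bW using s c L by (simp add: power_divide)
    also have "b1\<^sup>2 * (Q / L\<^sup>2) = (b1 / L)\<^sup>2 * Q" by (simp add: power_divide)
    finally have f: "f (g x) = L / (b1 * sqrt Q)"
      unfolding f_def using b1 L by (simp add: real_sqrt_mult)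
    have "\<bar>g' x\<bar> = g' x"
      using w'_pos[OF x] b1 by (simp add: g'_def)
    also have "g' x = 2 * b1 / L"
      unfolding g'_def W_def[symmetric] bW w' using s c L by (simp add: field_simps power2_eq_square)
    finally have "\<bar>g' x\<bar> * f (g x) = 2 * (1 / sqrt Q)"
      unfolding f using b1 L by simp
    then show ?thesis by (simp add: Q_def s_def c_def)
  qed
  have "integral {-(pi/2)<..<pi/2} f = 2 * agm_integral a b"
  proof -
    have "f absolutely_integrable_on {-(pi/2)..pi/2}"
      unfolding f_def by (intro absolutely_integrable_continuous_real continuous_on_agm_integrand a1 b1)
    then have "f absolutely_integrable_on {-(pi/2)<..<pi/2}"
      by (rule set_integrable_subset) auto
    then have "integral (g ` S) f = integral S (\<lambda>x. \<bar>g' x\<bar> * f (g x))"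
      using has_absolute_integral_change_of_variables_1'[of S g g' f "integral (g ` S) f"] g inj
      unfolding img by (auto simp: S_def)
    also have "\<dots> = integral S (\<lambda>x. 2 * (1 / sqrt (a\<^sup>2 * (cos x)\<^sup>2 + b\<^sup>2 * (sin x)\<^sup>2)))"
      by (intro integral_cong fg)
    also have "\<dots> = 2 * integral S (\<lambda>x. 1 / sqrt (a\<^sup>2 * (cos x)\<^sup>2 + b\<^sup>2 * (sin x)\<^sup>2))"
      by (rule Henstock_Kurzweil_Integration.integral_mult_right)
    finally show ?thesis
      unfolding img by (simp only: S_def agm_integral_def integral_open_interval_real)
  qed
  moreover have "integral {-(pi/2)<..<pi/2} f = 2 * agm_integral a1 b1"
  proof -
    have "integral {-(pi/2)<..<pi/2} f = integral {-(pi/2)..pi/2} f"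
      by (simp add: integral_open_interval_real)
    also have "\<dots> = integral {-(pi/2)..0} f + integral {0..pi/2} f"
      unfolding f_def
      by (intro Henstock_Kurzweil_Integration.integral_combine[symmetric] agm_integrand_integrable a1 b1) auto
    also have "integral {-(pi/2)..0} f = integral {-(pi/2)..0} (\<lambda>x. f (- x))"
      by (simp add: f_def)
    also have "\<dots> = integral {0..pi/2} f"
      by (simp only: Henstock_Kurzweil_Integration.integral_reflect_real[of "pi/2" 0 f, symmetric, unfolded minus_zero])
    finally show ?thesis by (simp add: agm_integral_def f_def)
  qed
  ultimately show ?thesis by (simp add: a1_def b1_def)
qed

text \<open>For these arguments the radicand is 1 + cos^2 x. Substituting w = cos^4 x and using 1 -
  w = sin^2 x (1 + cos^2 x) produces the Beta integrand.\<close>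

lemma agm_integral_lemniscatic: "agm_integral (sqrt 2) 1 = Beta (1 / 4) (1 / 2) / 4"
proof -
  define f where "f = (\<lambda>w::real. w powr (1 / 4 - 1) * (1 - w) powr (1 / 2 - 1))"
  define g where "g = (\<lambda>x::real. cos x ^ 4)"
  define g' where "g' = (\<lambda>x::real. - (4 * cos x ^ 3 * sin x))"
  define S where "S = {0<..<pi/2}"
  have sc: "sin x > 0" "cos x > 0" "cos x < 1" if "x \<in> S" for x
  proof -
    show "sin x > 0" "cos x > 0"
      using that by (auto simp: S_def intro!: sin_gt_zero cos_gt_zero)
    have "cos x < cos 0"
      using that by (intro cos_monotone_0_pi) (auto simp: S_def)
    then show "cos x < 1" by simp
  qed
  have g: "(g has_field_derivative g' x) (at x within S)" for x
    unfolding g_def g'_def by (auto intro!: derivative_eq_intros)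
  have inj: "inj_on g S"
  proof (rule inj_onI)
    fix x y assume x: "x \<in> S" and y: "y \<in> S" and "g x = g y"
    then have "cos x = cos y"
      using sc[OF x] sc[OF y] power_eq_iff_eq_base[of 4 "cos x" "cos y"] by (simp add: g_def)
    with x y show "x = y" using cos_inj_pi[of x y] by (auto simp: S_def)
  qed
  have img: "g ` S = {0<..<1}"
  proof (intro equalityI subsetI)
    fix y assume "y \<in> g ` S"
    then obtain x where x: "x \<in> S" and y: "y = cos x ^ 4" by (auto simp: g_def)
    show "y \<in> {0<..<1}" using sc[OF x] by (simp add: y power_less_one_iff)
  next
    fix y :: real assume y: "y \<in> {0<..<1}"
    define c where "c = root 4 y"
    have c: "0 < c" "c < 1" "c ^ 4 = y" using y by (auto simp: c_def)
    have "arccos c \<in> S" using c arccos_lt_bounded[of c] arccos_less_arccos[of 0 c]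
      by (auto simp: S_def)
    moreover have "g (arccos c) = y" using c by (simp add: g_def)
    ultimately show "y \<in> g ` S" by blast
  qed
  have fg: "\<bar>g' x\<bar> * f (g x) = 4 * (1 / sqrt ((sqrt 2)\<^sup>2 * (cos x)\<^sup>2 + 1\<^sup>2 * (sin x)\<^sup>2))" if x: "x \<in> S" for x
  proof -
    define s c where "s = sin x" and "c = cos x"
    have s: "s > 0" and c: "c > 0" using sc[OF x] by (auto simp: s_def c_def)
    have s2: "s\<^sup>2 = 1 - c\<^sup>2" by (simp add: s_def c_def sin_squared_eq)
    have "1 - c ^ 4 = s\<^sup>2 * (1 + c\<^sup>2)"
      unfolding s2 by (simp add: algebra_simps flip: power_add)
    then have "(1 - c ^ 4) powr (1 / 2 - 1) = 1 / (s * sqrt (1 + c\<^sup>2))"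
      using s c by (simp add: powr_minus_divide powr_half_sqrt real_sqrt_mult)
    moreover have "(c ^ 4) powr (1 / 4 - 1) = 1 / c ^ 3"
    proof -
      have "(c ^ 4) powr (1 / 4 - 1) = (c powr 4) powr (1 / 4 - 1)"
        using c by (simp add: powr_numeral)
      also have "\<dots> = c powr (- 3)" by (simp add: powr_powr)
      finally show ?thesis using c by (simp add: powr_minus_divide powr_numeral)
    qed
    ultimately have "\<bar>g' x\<bar> * f (g x) = 4 * (1 / sqrt (1 + c\<^sup>2))"
      using s c by (simp add: f_def g_def g'_def s_def[symmetric] c_def[symmetric] abs_mult)
    also have "1 + c\<^sup>2 = (sqrt 2)\<^sup>2 * (cos x)\<^sup>2 + 1\<^sup>2 * (sin x)\<^sup>2"
      using s2 by (simp add: s_def c_def)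
    finally show ?thesis .
  qed
  have B: "(f has_integral Beta (1 / 4) (1 / 2)) {0<..<1}"
    using has_integral_Beta_real[of "1 / 4" "1 / 2"] by (simp add: f_def has_integral_Icc_iff_Ioo)
  have "f absolutely_integrable_on (g ` S)"
    unfolding img using B by (intro nonnegative_absolutely_integrable_1) (auto simp: f_def)
  then have "integral (g ` S) f = integral S (\<lambda>x. \<bar>g' x\<bar> * f (g x))"
    using has_absolute_integral_change_of_variables_1'[of S g g' f "integral (g ` S) f"] g inj
    by (auto simp: S_def)
  also have "\<dots> = integral S (\<lambda>x. 4 * (1 / sqrt ((sqrt 2)\<^sup>2 * (cos x)\<^sup>2 + 1\<^sup>2 * (sin x)\<^sup>2)))"
    by (intro integral_cong fg)
  also have "\<dots> = 4 * integral S (\<lambda>x. 1 / sqrt ((sqrt 2)\<^sup>2 * (cos x)\<^sup>2 + 1\<^sup>2 * (sin x)\<^sup>2))"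
    by (rule Henstock_Kurzweil_Integration.integral_mult_right)
  also have "\<dots> = 4 * agm_integral (sqrt 2) 1"
    by (simp only: S_def agm_integral_def integral_open_interval_real)
  finally show ?thesis
    using B by (simp add: img integral_unique)
qed

text \<open>Only the logarithmic singularity matters later, so a crude additive constant suffices.
  The comparison functions have explicit antiderivatives: arsinh(sin x / e) from below, and
  arsinh(tan x / e) from above on [0, pi/4]; on the remaining interval the integrand is at most
  2.\<close>

lemma agm_integral_log_bounds:
  assumes e: "0 < e" "e < 1"
  shows "ln (1 / e) \<le> agm_integral e 1" "agm_integral e 1 \<le> ln (1 / e) + 4"
proof -
  let ?f = "\<lambda>x. 1 / sqrt (e\<^sup>2 * (cos x)\<^sup>2 + 1\<^sup>2 * (sin x)\<^sup>2)"
  have pos: "e\<^sup>2 * (cos x)\<^sup>2 + (sin x)\<^sup>2 > 0" for x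
    using agm_quadratic_pos[of e 1 x] e by simp
  have ars: "ln (1 / e) \<le> arsinh (1 / e)" "arsinh (1 / e) \<le> ln (1 / e) + 2"
  proof -
    have "1 / e \<le> 1 / e + sqrt ((1 / e)\<^sup>2 + 1)" by simp
    then show "ln (1 / e) \<le> arsinh (1 / e)"
      unfolding arsinh_real_def using e by (subst ln_le_cancel_iff) (auto intro!: add_pos_nonneg)
    have "sqrt ((1 / e)\<^sup>2 + 1) \<le> 1 / e + 1"
      using e by (intro real_le_lsqrt) (auto simp: power2_sum)
    also have "1 / e + 1 \<le> 2 * (1 / e)"
    proof -
      have "1 \<le> 1 / e" using e by simp
      then show ?thesis by linarith
    qed
    finally have "arsinh (1 / e) \<le> ln (3 * (1 / e))"
      unfolding arsinh_real_def using e by (subst ln_le_cancel_iff) (auto intro!: add_pos_nonneg)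
    also have "\<dots> = ln (1 / e) + ln 3" using e by (subst ln_mult) auto
    also have "ln 3 \<le> (2::real)" using ln_le_minus_one[of 3] by simp
    finally show "arsinh (1 / e) \<le> ln (1 / e) + 2" by simp
  qed
  have "((\<lambda>x. cos x / sqrt ((sin x)\<^sup>2 + e\<^sup>2)) has_integral (arsinh (sin (pi/2) / e) - arsinh (sin 0 / e))) {0..pi/2}"
  proof (intro fundamental_theorem_of_calculus)
    fix x
    have "((\<lambda>x. arsinh (sin x / e)) has_field_derivative (1 / sqrt ((sin x / e)\<^sup>2 + 1) * (cos x / e))) (at x)"
      by (rule DERIV_chain2[OF arsinh_real_has_field_derivative]) (use e in \<open>auto intro!: derivative_eq_intros\<close>)
    also have "1 / sqrt ((sin x / e)\<^sup>2 + 1) * (cos x / e) = cos x / sqrt ((sin x)\<^sup>2 + e\<^sup>2)"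
    proof -
      have "(sin x / e)\<^sup>2 + 1 = ((sin x)\<^sup>2 + e\<^sup>2) / e\<^sup>2" using e by (simp add: field_simps)
      then show ?thesis using e by (simp add: real_sqrt_divide)
    qed
    finally show "((\<lambda>x. arsinh (sin x / e)) has_vector_derivative cos x / sqrt ((sin x)\<^sup>2 + e\<^sup>2)) (at x within {0..pi/2})"
      by (simp add: has_real_derivative_iff_has_vector_derivative[symmetric] has_field_derivative_at_within)
  qed simp
  moreover have "(?f has_integral agm_integral e 1) {0..pi/2}"
    unfolding agm_integral_def using agm_integrand_integrable[of e 1] e by (intro integrable_integral) auto
  ultimately have "arsinh (sin (pi/2) / e) - arsinh (sin 0 / e) \<le> agm_integral e 1"
  proof (rule has_integral_le)
    fix x :: real assume x: "x \<in> {0..pi/2}"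
    then have c: "cos x \<ge> 0" by (intro cos_ge_zero) auto
    have "e\<^sup>2 * (cos x)\<^sup>2 \<le> e\<^sup>2 * 1" by (intro mult_left_mono) (auto simp: abs_square_le_1)
    then have "e\<^sup>2 * (cos x)\<^sup>2 + (sin x)\<^sup>2 \<le> (sin x)\<^sup>2 + e\<^sup>2" by simp
    then have "cos x / sqrt ((sin x)\<^sup>2 + e\<^sup>2) \<le> 1 / sqrt (e\<^sup>2 * (cos x)\<^sup>2 + (sin x)\<^sup>2)"
      using pos[of x] c by (intro frac_le) auto
    then show "cos x / sqrt ((sin x)\<^sup>2 + e\<^sup>2) \<le> ?f x" by simp
  qed
  then show "ln (1 / e) \<le> agm_integral e 1" using ars by simp
  have "((\<lambda>x. 1 / (cos x * sqrt (e\<^sup>2 * (cos x)\<^sup>2 + (sin x)\<^sup>2))) has_integral (arsinh (tan (pi/4) / e) - arsinh (tan 0 / e))) {0..pi/4}"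
  proof (intro fundamental_theorem_of_calculus)
    fix x assume "x \<in> {0..pi/4}"
    then have c: "cos x > 0" by (intro cos_gt_zero_pi) (use pi_gt_zero in \<open>auto simp del: pi_gt_zero\<close>)
    have "((\<lambda>x. arsinh (tan x / e)) has_field_derivative (1 / sqrt ((tan x / e)\<^sup>2 + 1) * (inverse ((cos x)\<^sup>2) / e))) (at x)"
      by (rule DERIV_chain2[OF arsinh_real_has_field_derivative]) (use e c in \<open>auto intro!: derivative_eq_intros\<close>)
    also have "1 / sqrt ((tan x / e)\<^sup>2 + 1) * (inverse ((cos x)\<^sup>2) / e) = 1 / (cos x * sqrt (e\<^sup>2 * (cos x)\<^sup>2 + (sin x)\<^sup>2))"
    proof -
      have "(tan x / e)\<^sup>2 + 1 = (e\<^sup>2 * (cos x)\<^sup>2 + (sin x)\<^sup>2) / (e * cos x)\<^sup>2"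
        using e c by (simp add: tan_def field_simps)
      then have "sqrt ((tan x / e)\<^sup>2 + 1) = sqrt (e\<^sup>2 * (cos x)\<^sup>2 + (sin x)\<^sup>2) / (e * cos x)"
        using e c by (simp add: real_sqrt_divide)
      then show ?thesis using e c by (simp add: power2_eq_square field_simps)
    qed
    finally show "((\<lambda>x. arsinh (tan x / e)) has_vector_derivative 1 / (cos x * sqrt (e\<^sup>2 * (cos x)\<^sup>2 + (sin x)\<^sup>2))) (at x within {0..pi/4})"
      by (simp add: has_real_derivative_iff_has_vector_derivative[symmetric] has_field_derivative_at_within)
  qed simp
  then have 1: "integral {0..pi/4} ?f \<le> arsinh (tan (pi/4) / e) - arsinh (tan 0 / e)"
  proof (rule has_integral_le[OF integrable_integral, rotated])
    show "?f integrable_on {0..pi/4}" using agm_integrand_integrable[of e 1] e by auto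
    fix x :: real assume "x \<in> {0..pi/4}"
    then have c: "cos x > 0" by (intro cos_gt_zero_pi) (use pi_gt_zero in \<open>auto simp del: pi_gt_zero\<close>)
    have "1 / sqrt (e\<^sup>2 * (cos x)\<^sup>2 + (sin x)\<^sup>2) \<le> 1 / (cos x * sqrt (e\<^sup>2 * (cos x)\<^sup>2 + (sin x)\<^sup>2))"
      using pos[of x] c by (intro divide_left_mono) (auto intro!: mult_left_le_one_le mult_pos_pos)
    then show "?f x \<le> 1 / (cos x * sqrt (e\<^sup>2 * (cos x)\<^sup>2 + (sin x)\<^sup>2))" by simp
  qed
  have 2: "integral {pi/4..pi/2} ?f \<le> integral {pi/4..pi/2} (\<lambda>x. 2)"
  proof (rule integral_le)
    show "?f integrable_on {pi/4..pi/2}" using agm_integrand_integrable[of e 1] e by auto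
    fix x :: real assume x: "x \<in> {pi/4..pi/2}"
    have "sqrt 2 / 2 \<le> sin x"
      using x sin_monotone_2pi_le[of "pi/4" x] by (simp add: sin_45)
    moreover have "1 / 2 \<le> sqrt 2 / (2::real)" by simp
    ultimately have "1 / 2 \<le> sin x" by linarith
    then have "(1 / 2)\<^sup>2 \<le> (sin x)\<^sup>2" by (intro power_mono) auto
    then have "(1 / 2)\<^sup>2 \<le> e\<^sup>2 * (cos x)\<^sup>2 + (sin x)\<^sup>2" by (simp add: add_increasing)
    then have "1 / 2 \<le> sqrt (e\<^sup>2 * (cos x)\<^sup>2 + (sin x)\<^sup>2)" by (intro real_le_rsqrt) 
    then show "?f x \<le> 2" using pos[of x] by (simp add: field_simps)
  qed (rule integrable_const_ivl)
  have "agm_integral e 1 = integral {0..pi/4} ?f + integral {pi/4..pi/2} ?f"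
    unfolding agm_integral_def
    by (intro Henstock_Kurzweil_Integration.integral_combine[symmetric] agm_integrand_integrable)
      (use e pi_gt_zero in \<open>auto simp del: pi_gt_zero\<close>)
  \<comment> \<open>The second piece is at most 2 * pi / 4 < 2; passing from arsinh to the logarithm
    costs another 2.\<close>
  also have "\<dots> \<le> arsinh (1 / e) + 2"
    using 1 2 pi_less_4 by (simp add: tan_45)
  finally show "agm_integral e 1 \<le> ln (1 / e) + 4" using ars by simp
qed

section \<open>Inversion\<close>

lemma eventually_at_right_01: "\<forall>\<^sub>F q :: real in at_right 0. q \<in> {0<..<1}"
  unfolding eventually_at_right_field by (intro exI[of _ 1]) auto

text \<open>Doubling the nome replaces the arguments by their means, which leaves the integral
  unchanged by \<open>agm_integral_gauss\<close>; at 0 both arguments tend to 1.\<close>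

lemma agm_integral_nome_theta:
  assumes q: "q \<in> {0<..<1}"
  shows "agm_integral ((nome_theta q)\<^sup>2) ((nome_theta (- q))\<^sup>2) = pi / 2"
proof -
  define h where "h q = agm_integral ((nome_theta q)\<^sup>2) ((nome_theta (- q))\<^sup>2)" for q
  have "h (q\<^sup>2) = h q" if q: "q \<in> {0<..<1}" for q
  proof -
    define x y where xy: "x = (nome_theta q)\<^sup>2" "y = (nome_theta (- q))\<^sup>2"
    have "x * y = ((nome_theta (- (q\<^sup>2)))\<^sup>2)\<^sup>2"
      using nome_square_doubling(2)[OF q, folded xy] by simp
    then have "(nome_theta (- (q\<^sup>2)))\<^sup>2 = sqrt (x * y)"
      by (simp only: real_sqrt_abs abs_power2)
    then have "h (q\<^sup>2) = agm_integral ((x + y) / 2) (sqrt (x * y))"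
      unfolding h_def nome_square_doubling(1)[OF q, folded xy] by (rule arg_cong)
    also have "\<dots> = h q"
      unfolding h_def xy[symmetric] using nome_squares[OF q, folded xy] by (intro agm_integral_gauss) auto
    finally show ?thesis .
  qed
  moreover have "(h \<longlongrightarrow> pi / 2) (at_right 0)"
  proof (rule tendsto_sandwich)
    show "((\<lambda>q. pi / (2 * (nome_theta q)\<^sup>2)) \<longlongrightarrow> pi / 2) (at_right 0)"
      "((\<lambda>q. pi / (2 * (nome_theta (- q))\<^sup>2)) \<longlongrightarrow> pi / 2) (at_right 0)"
      by (auto intro!: tendsto_eq_intros tendsto_nome_theta_at_0)
    show "\<forall>\<^sub>F q in at_right 0. pi / (2 * (nome_theta q)\<^sup>2) \<le> h q"
      using eventually_at_right_01
      by eventually_elim (use nome_squares in \<open>auto simp: h_def less_imp_le intro!: agm_integral_bounds\<close>)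
    show "\<forall>\<^sub>F q in at_right 0. h q \<le> pi / (2 * (nome_theta (- q))\<^sup>2)"
      using eventually_at_right_01
      by eventually_elim (use nome_squares in \<open>auto simp: h_def less_imp_le intro!: agm_integral_bounds\<close>)
  qed
  ultimately have "h q = pi / 2" using q by (rule squaring_invariant_unique)
  then show ?thesis by (simp add: h_def)
qed

text \<open>Doubling sends (x, c) to ((x + y) / 2, (x - y) / 2), whose means are x / 2 and c / 2.
  Hence the integral doubles, as does - ln q, and their quotient is invariant. Its limit follows
  from the logarithmic singularity, since c behaves like 4 sqrt q.\<close>

lemma agm_integral_nome_theta_complementary:
  assumes q: "q \<in> {0<..<1}"
  shows "agm_integral ((nome_theta q)\<^sup>2) (sqrt (nome_theta q ^ 4 - nome_theta (- q) ^ 4)) = - ln q / 2"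
proof -
  define c where "c q = sqrt (nome_theta q ^ 4 - nome_theta (- q) ^ 4)" for q
  define k where "k q = agm_integral ((nome_theta q)\<^sup>2) (c q) / (- ln q)" for q
  have diff_pos: "nome_theta q ^ 4 - nome_theta (- q) ^ 4 > 0" if q: "q \<in> {0<..<1}" for q
    using nome_theta_minus_less[OF q] nome_theta_pos[of "- q"] that by (auto intro!: power_strict_mono)
  have "k (q\<^sup>2) = k q" if q: "q \<in> {0<..<1}" for q
  proof -
    define x y where xy: "x = (nome_theta q)\<^sup>2" "y = (nome_theta (- q))\<^sup>2"
    note sq = nome_squares[OF q, folded xy] and dbl = nome_square_doubling[OF q, folded xy]
    have cq: "(c q)\<^sup>2 = x\<^sup>2 - y\<^sup>2" "c q > 0"
      using diff_pos[OF q] by (simp_all add: c_def xy)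
    have q2: "q\<^sup>2 \<in> {0<..<1}" using q by (auto simp: power_less_one_iff)
    have "(c (q\<^sup>2))\<^sup>2 = ((x + y) / 2)\<^sup>2 - x * y"
    proof -
      have "nome_theta (q\<^sup>2) ^ 4 = ((x + y) / 2)\<^sup>2"
        using power4_eq_square_square dbl(1) by metis
      then show ?thesis using diff_pos[OF q2] dbl(2) by (simp add: c_def)
    qed
    also have "\<dots> = ((x - y) / 2)\<^sup>2" by (simp add: field_simps power2_eq_square)
    finally have c1: "c (q\<^sup>2) = (x - y) / 2"
      using sq diff_pos[OF q2] by (subst (asm) power2_eq_iff_nonneg) (auto simp: c_def less_imp_le)
    have "agm_integral ((x + y) / 2) ((x - y) / 2)
      = agm_integral (((x + y) / 2 + (x - y) / 2) / 2) (sqrt ((x + y) / 2 * ((x - y) / 2)))"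
      using sq by (intro agm_integral_gauss[symmetric]) auto
    also have "((x + y) / 2 + (x - y) / 2) / 2 = 1 / 2 * x" by (simp add: field_simps)
    also have "(x + y) / 2 * ((x - y) / 2) = (1 / 2 * c q)\<^sup>2"
      unfolding power_mult_distrib cq by (simp add: field_simps power2_eq_square)
    also have "sqrt \<dots> = 1 / 2 * c q" using cq by (simp only: real_sqrt_abs abs_mult)
    also have "agm_integral (1 / 2 * x) (1 / 2 * c q) = 2 * agm_integral x (c q)"
      by (subst agm_integral_scale) auto
    finally show ?thesis
      using q unfolding k_def c1 dbl(1) by (simp add: ln_realpow xy)
  qed
  moreover have "(k \<longlongrightarrow> 1 / 2) (at_right 0)"
  proof -
    \<comment> \<open>\<open>B\<close> is the remainder in ln (1 / e) = - ln q / 2 + B q for the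
      ratio e = c / x. It converges, so dividing by - ln q removes it in the limit.\<close>
    define B where "B q = ln ((nome_theta q)\<^sup>2) - ln ((nome_theta q ^ 4 - nome_theta (- q) ^ 4) / q) / 2" for q
    have B: "(B \<longlongrightarrow> ln (1\<^sup>2) - ln 16 / 2) (at_right 0)"
      unfolding B_def by (intro tendsto_intros tendsto_nome_theta_at_0) auto
    have ln: "filterlim (\<lambda>q::real. - ln q) at_top (at_right 0)"
      using ln_at_0 by (simp add: filterlim_uminus_at_top)
    have lo: "((\<lambda>q. (1 / 2 + B q / (- ln q)) / (nome_theta q)\<^sup>2) \<longlongrightarrow> (1 / 2 + 0) / 1\<^sup>2) (at_right 0)"
      by (intro tendsto_intros tendsto_nome_theta_at_0 real_tendsto_divide_at_top[OF B ln]) auto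
    have up: "((\<lambda>q. (1 / 2 + (B q + 4) / (- ln q)) / (nome_theta q)\<^sup>2) \<longlongrightarrow> (1 / 2 + 0) / 1\<^sup>2) (at_right 0)"
      by (intro tendsto_intros tendsto_nome_theta_at_0
          real_tendsto_divide_at_top[OF tendsto_add[OF B tendsto_const] ln]) auto
    have bounds: "(1 / 2 + B q / (- ln q)) / (nome_theta q)\<^sup>2 \<le> k q \<and>
      k q \<le> (1 / 2 + (B q + 4) / (- ln q)) / (nome_theta q)\<^sup>2" if q: "q \<in> {0<..<1}" for q
    proof -
      define x where "x = (nome_theta q)\<^sup>2"
      have x: "x > 0" using nome_theta_pos[of q] q by (simp add: x_def)
      have c: "c q > 0" using diff_pos[OF q] by (simp add: c_def)
      have "nome_theta (- q) > 0" using nome_theta_pos[of "- q"] q by simp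
      then have "(c q)\<^sup>2 < x\<^sup>2" using diff_pos[OF q] by (simp add: c_def x_def)
      then have cx: "c q < x" by (rule power2_less_imp_less) (use x in simp)
      define e where "e = c q / x"
      have e: "0 < e" "e < 1" using c cx x by (auto simp: e_def)
      have "ln (c q) = ln (nome_theta q ^ 4 - nome_theta (- q) ^ 4) / 2"
        using diff_pos[OF q] by (simp add: c_def ln_sqrt)
      then have eB: "ln (1 / e) = (- ln q) / 2 + B q"
        using x c q diff_pos[OF q] by (simp add: e_def ln_div B_def x_def[symmetric] field_simps)
      have "agm_integral x (c q) = agm_integral (c q) x" by (rule agm_integral_commute)
      also have "\<dots> = agm_integral (x * e) (x * 1)" using x by (simp add: e_def)
      also have "\<dots> = agm_integral e 1 / x" using x by (rule agm_integral_scale)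
      finally have k: "k q = (agm_integral e 1 / (- ln q)) / x" by (simp add: k_def x_def)
      have l: "- ln q > 0" using q by simp
      have le: "((- ln q) / 2 + B q) / (- ln q) \<le> agm_integral e 1 / (- ln q)"
        "agm_integral e 1 / (- ln q) \<le> ((- ln q) / 2 + B q + 4) / (- ln q)"
        using agm_integral_log_bounds[OF e] l unfolding eB by (auto intro!: divide_right_mono simp del: divide_minus_right)
      have eq: "((- ln q) / 2 + B q) / (- ln q) = 1 / 2 + B q / (- ln q)"
        "((- ln q) / 2 + B q + 4) / (- ln q) = 1 / 2 + (B q + 4) / (- ln q)"
        using l by (simp_all add: field_simps)
      show ?thesis
        unfolding k x_def[symmetric] by (intro conjI divide_right_mono le[unfolded eq] less_imp_le[OF x])
    qed
    show ?thesis
    proof (rule tendsto_sandwich)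
      show "((\<lambda>q. (1 / 2 + B q / (- ln q)) / (nome_theta q)\<^sup>2) \<longlongrightarrow> 1 / 2) (at_right 0)"
        "((\<lambda>q. (1 / 2 + (B q + 4) / (- ln q)) / (nome_theta q)\<^sup>2) \<longlongrightarrow> 1 / 2) (at_right 0)"
        using lo up by simp_all
      show "\<forall>\<^sub>F q in at_right 0. (1 / 2 + B q / (- ln q)) / (nome_theta q)\<^sup>2 \<le> k q"
        using eventually_at_right_01 by eventually_elim (use bounds in blast)
      show "\<forall>\<^sub>F q in at_right 0. k q \<le> (1 / 2 + (B q + 4) / (- ln q)) / (nome_theta q)\<^sup>2"
        using eventually_at_right_01 by eventually_elim (use bounds in blast)
    qed
  qed
  ultimately have "k q = 1 / 2" using q by (rule squaring_invariant_unique)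
  moreover have "ln q \<noteq> 0" using q by simp
  ultimately show ?thesis by (simp add: k_def c_def field_simps)
qed

text \<open>The modulus \<open>Y / X\<close> and its complement \<open>C / X\<close> determine \<open>t\<close> as a strictly monotone quotient of
  the two integrals; exchanging them inverts \<open>t\<close>.\<close>

lemma nome_theta_inversion:
  fixes t :: real
  assumes t: "t > 0"
  defines "X \<equiv> \<lambda>t. (nome_theta (exp (- pi * t)))\<^sup>2" and "Y \<equiv> \<lambda>t. (nome_theta (- exp (- pi * t)))\<^sup>2"
  shows "X (1 / t) = t * X t"
    and "(Y (1 / t) / X (1 / t))\<^sup>2 = 1 - (Y t / X t)\<^sup>2"
proof -
  define C where "C = (\<lambda>t. sqrt ((X t)\<^sup>2 - (Y t)\<^sup>2))"
  define r r' where "r = (\<lambda>t. Y t / X t)" and "r' = (\<lambda>t. C t / X t)"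
  have basic: "X t > 0" "r t > 0" "r' t > 0" "(r t)\<^sup>2 + (r' t)\<^sup>2 = 1"
    "agm_integral 1 (r t) = X t * (pi / 2)" "agm_integral 1 (r' t) = t * agm_integral 1 (r t)"
    if "t > 0" for t
  proof -
    have q: "exp (- pi * t) \<in> {0<..<1}" using that by auto
    have XY: "0 < Y t" "Y t < X t" unfolding X_def Y_def using nome_squares[OF q] by auto
    show X: "X t > 0" and r: "r t > 0" using XY by (auto simp: r_def)
    have "(X t)\<^sup>2 - (Y t)\<^sup>2 > 0" using XY by (auto intro!: power_strict_mono)
    then have C: "C t > 0" "(C t)\<^sup>2 = (X t)\<^sup>2 - (Y t)\<^sup>2" by (simp_all add: C_def)
    then show r': "r' t > 0" using X by (simp add: r'_def)
    show "(r t)\<^sup>2 + (r' t)\<^sup>2 = 1"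
      using X C(2) by (simp add: r_def r'_def power_divide add_divide_distrib[symmetric])
    have "agm_integral (X t * 1) (X t * r t) = pi / 2"
      using agm_integral_nome_theta[OF q] X by (simp add: r_def X_def Y_def)
    then show 1: "agm_integral 1 (r t) = X t * (pi / 2)"
      unfolding agm_integral_scale[OF X] using X by (simp add: field_simps)
    have "agm_integral (X t * 1) (X t * r' t) = pi * t / 2"
      using agm_integral_nome_theta_complementary[OF q] X by (simp add: r'_def C_def X_def Y_def)
    then show "agm_integral 1 (r' t) = t * agm_integral 1 (r t)"
      unfolding agm_integral_scale[OF X] 1 using X by (simp add: field_simps)
  qed
  define s where "s = 1 / t"
  have s: "s > 0" using t by (simp add: s_def)
  note bt = basic[OF t] and bs = basic[OF s]
  \<comment> \<open>At 1 / t the quotient of the two integrals is the reciprocal of that at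
    t.\<close>
  have key: "agm_integral 1 (r s) = t * agm_integral 1 (r' s)"
    using bs(6) t by (simp add: s_def)
  \<comment> \<open>Suppose r s < r' t. Since each pair of squares sums to 1, also r t < r' s, and
    antimonotonicity in both places contradicts \<open>key\<close>. The opposite inequality fails in
    the same way.\<close>
  have "r s = r' t"
  proof (rule linorder_cases)
    assume less: "r s < r' t"
    have "(r s)\<^sup>2 < (r' t)\<^sup>2" using less bs by (intro power_strict_mono) auto
    then have "(r t)\<^sup>2 < (r' s)\<^sup>2" using bs(4) bt(4) by linarith
    then have "r t < r' s" using bs(3) by (intro power2_less_imp_less[of "r t"]) auto
    from agm_integral_strict_antimono[OF zero_less_one bt(2) this] have "t * agm_integral 1 (r' s) < t * agm_integral 1 (r t)"
      using t by simp
    also have "\<dots> < agm_integral 1 (r s)"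
      using agm_integral_strict_antimono[OF zero_less_one bs(2) less] bt(6) by simp
    finally show ?thesis using key by simp
  next
    assume less: "r' t < r s"
    have "(r' t)\<^sup>2 < (r s)\<^sup>2" using less bt by (intro power_strict_mono) auto
    then have "(r' s)\<^sup>2 < (r t)\<^sup>2" using bs(4) bt(4) by linarith
    then have "r' s < r t" using bt(2) by (intro power2_less_imp_less[of "r' s"]) auto
    from agm_integral_strict_antimono[OF zero_less_one bs(3) this] have "t * agm_integral 1 (r t) < t * agm_integral 1 (r' s)"
      using t by simp
    moreover have "agm_integral 1 (r s) < t * agm_integral 1 (r t)"
      using agm_integral_strict_antimono[OF zero_less_one bt(3) less] bt(6) by simp
    ultimately show ?thesis using key by simp
  qed
  then show "X (1 / t) = t * X t"
    using bs(5) bt(5,6) by (simp add: s_def)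
  show "(Y (1 / t) / X (1 / t))\<^sup>2 = 1 - (Y t / X t)\<^sup>2"
    using \<open>r s = r' t\<close> bt(4) by (simp add: r_def s_def)
qed

section \<open>Differential equations in t and values at 1\<close>

definition theta_logderiv :: "real \<Rightarrow> real" where
  "theta_logderiv t = - pi * (exp (- pi * t) * nome_logderiv (exp (- pi * t)))"

text \<open>Named after its modular weight; the value at 1 is \<open>psi2\<close>.\<close>

definition theta_weight2 :: "real \<Rightarrow> real" where
  "theta_weight2 t = pi * theta t ^ 4"

text \<open>In the classical notation this is \<open>\<pi> (\<theta>\<^sub>2\<^sup>4 - \<theta>\<^sub>4\<^sup>4)\<close>.\<close>

definition theta_odd :: "real \<Rightarrow> real" where
  "theta_odd t = theta_weight2 t - 2 * (pi * nome_theta (- exp (- pi * t)) ^ 4)"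

lemma theta_pos: "t > 0 \<Longrightarrow> theta t > 0"
  unfolding theta_eq_nome_theta by (intro nome_theta_pos) simp

lemma theta_has_derivative:
  assumes "t > 0"
  shows "(theta has_field_derivative theta t * theta_logderiv t) (at t)"
  unfolding theta_eq_nome_theta[abs_def] theta_logderiv_def
  using assms by (auto intro!: derivative_eq_intros)

lemma theta_weight2_has_derivative:
  assumes "t > 0"
  shows "(theta_weight2 has_field_derivative 4 * theta_logderiv t * theta_weight2 t) (at t)"
  unfolding theta_weight2_def[abs_def]
  using assms by (auto intro!: derivative_eq_intros theta_has_derivative simp: numeral_eq_Suc algebra_simps)

lemma theta_odd_has_derivative:
  assumes t: "t > 0"
  shows "(theta_odd has_field_derivative
    4 * theta_logderiv t * theta_odd t - ((theta_weight2 t)\<^sup>2 - (theta_odd t)\<^sup>2) / 2) (at t)"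
proof -
  define q where "q = exp (- pi * t)"
  have q: "q \<in> {0<..<1}" using t by (auto simp: q_def)
  define l A B where "l = theta_logderiv t" and "A = theta_weight2 t" and "B = pi * nome_theta (- q) ^ 4"
  have l: "l = - pi * (q * nome_logderiv q)" by (simp add: l_def theta_logderiv_def q_def)
  have A: "A = pi * nome_theta q ^ 4" by (simp add: A_def theta_weight2_def theta_eq_nome_theta q_def)
  have u: "theta_odd t = A - 2 * B" by (simp add: theta_odd_def A_def B_def q_def)
  have "pi * (4 * q * (nome_logderiv q + nome_logderiv (- q))) = A - B"
    unfolding nome_logderiv_add[OF q] A B_def by (simp add: algebra_simps)
  \<comment> \<open>The logarithmic derivative at \<open>- q\<close> is thus expressed by quantities
    already in the system, which is what closes it.\<close>
  then have b: "4 * pi * (q * nome_logderiv (- q)) = A - B + 4 * l"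
    unfolding l by (simp add: algebra_simps)
  have "((\<lambda>t. pi * nome_theta (- exp (- pi * t)) ^ 4) has_field_derivative B * (4 * pi * (q * nome_logderiv (- q)))) (at t)"
    using t unfolding B_def q_def
    by (auto intro!: derivative_eq_intros simp: numeral_eq_Suc algebra_simps)
  from DERIV_diff[OF theta_weight2_has_derivative[OF t] DERIV_cmult[OF this, of 2]]
  have "(theta_odd has_field_derivative 4 * l * A - 2 * (B * (4 * pi * (q * nome_logderiv (- q))))) (at t)"
    unfolding theta_odd_def[abs_def] l_def A_def .
  also have "4 * l * A - 2 * (B * (4 * pi * (q * nome_logderiv (- q)))) = 4 * l * theta_odd t - (A\<^sup>2 - (theta_odd t)\<^sup>2) / 2"
    unfolding b u by (simp add: field_simps power2_eq_square)
  finally show ?thesis by (simp add: l_def A_def)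
qed

lemma theta_logderiv_has_derivative:
  assumes t: "t > 0"
  shows "(theta_logderiv has_field_derivative
    2 * (theta_logderiv t)\<^sup>2 + ((theta_weight2 t)\<^sup>2 - (theta_odd t)\<^sup>2) / 32) (at t)"
proof -
  define q where "q = exp (- pi * t)"
  have q: "q \<in> {0<..<1}" using t by (auto simp: q_def)
  define A B where "A = theta_weight2 t" and "B = pi * nome_theta (- q) ^ 4"
  have l: "theta_logderiv t = - pi * (q * nome_logderiv q)" by (simp add: theta_logderiv_def q_def)
  have A: "A = pi * nome_theta q ^ 4" by (simp add: A_def theta_weight2_def theta_eq_nome_theta q_def)
  have u: "theta_odd t = A - 2 * B" by (simp add: theta_odd_def A_def B_def q_def)
  have "(theta_logderiv has_field_derivative pi\<^sup>2 / 2 * (2 * q * (nome_logderiv q + q * nome_logderiv' q))) (at t)"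
    using t unfolding theta_logderiv_def[abs_def] q_def
    by (auto intro!: derivative_eq_intros simp: field_simps power2_eq_square)
  also have "2 * q * (nome_logderiv q + q * nome_logderiv' q)
    = 4 * (q * nome_logderiv q)\<^sup>2 + (nome_theta q ^ 4 - nome_theta (- q) ^ 4) * nome_theta (- q) ^ 4 / 4"
    using nome_logderiv'_eq[OF q] by linarith
  also have "pi\<^sup>2 / 2 * \<dots> = 2 * (theta_logderiv t)\<^sup>2 + (A - B) * B / 8"
    unfolding l A B_def by (simp add: field_simps power2_eq_square)
  \<comment> \<open>From u = A - 2 B one gets B = (A - u) / 2 and A - B = (A + u) / 2, hence the
    denominator 32.\<close>
  also have "(A - B) * B / 8 = (A\<^sup>2 - (theta_odd t)\<^sup>2) / 32"
    unfolding u by (simp add: field_simps power2_eq_square)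
  finally show ?thesis by (simp add: A_def)
qed

text \<open>Differentiating the inversion formula at its fixed point t = 1 and dividing by the
  square of theta gives - 2 l = 1 + 2 l.\<close>

lemma theta_logderiv_1: "theta_logderiv 1 = - 1 / 4"
proof -
  have eq: "(theta (1 / t))\<^sup>2 = t * (theta t)\<^sup>2" if "t > 0" for t
    using nome_theta_inversion(1)[OF that] by (simp add: theta_eq_nome_theta)
  have "((\<lambda>t. (theta (1 / t))\<^sup>2) has_field_derivative 2 * theta 1 * (theta 1 * theta_logderiv 1 * - 1)) (at 1)"
  proof -
    have "((\<lambda>t. 1 / t :: real) has_field_derivative - 1) (at 1)"
      by (auto intro!: derivative_eq_intros)
    then have "((\<lambda>t. theta (1 / t)) has_field_derivative theta 1 * theta_logderiv 1 * - 1) (at 1)"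
      using DERIV_chain2[of theta "theta 1 * theta_logderiv 1" "\<lambda>t. 1 / t" 1 "- 1" UNIV]
        theta_has_derivative[of 1] by simp
    then show ?thesis by (auto intro!: derivative_eq_intros)
  qed
  note d1 = this
  have d2: "((\<lambda>t. t * (theta t)\<^sup>2) has_field_derivative (theta 1)\<^sup>2 + 2 * theta 1 * (theta 1 * theta_logderiv 1)) (at 1)"
    by (auto intro!: derivative_eq_intros theta_has_derivative)
  have ev: "\<forall>\<^sub>F t in nhds 1. (theta (1 / t))\<^sup>2 = t * (theta t)\<^sup>2"
  proof -
    have "\<forall>\<^sub>F t in nhds (1::real). t \<in> {0<..}" by (intro eventually_nhds_in_open) auto
    then show ?thesis by eventually_elim (use eq in auto)
  qed
  have "2 * theta 1 * (theta 1 * theta_logderiv 1 * - 1) = (theta 1)\<^sup>2 + 2 * theta 1 * (theta 1 * theta_logderiv 1)"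
    using DERIV_unique[OF d1[unfolded DERIV_cong_ev[OF refl ev refl]] d2] .
  then have "(theta 1)\<^sup>2 * (4 * theta_logderiv 1 + 1) = 0"
    by (simp add: algebra_simps power2_eq_square)
  then show ?thesis using theta_pos[of 1] by simp
qed

text \<open>At t = 1 the modulus coincides with its complement, so its square is 1 / 2.\<close>

lemma nome_theta_lemniscatic:
  "(nome_theta (exp (- pi))) ^ 4 = 2 * (nome_theta (- exp (- pi))) ^ 4"
proof -
  have pos: "nome_theta (exp (- pi)) > 0" by (intro nome_theta_pos) simp
  have "((nome_theta (- exp (- pi)))\<^sup>2 / (nome_theta (exp (- pi)))\<^sup>2)\<^sup>2 = 1 / 2"
    using nome_theta_inversion(2)[of 1] by simp
  then show ?thesis using pos by (simp add: power_divide field_simps)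
qed

lemma theta_odd_1: "theta_odd 1 = 0"
  using nome_theta_lemniscatic by (simp add: theta_odd_def theta_weight2_def theta_eq_nome_theta)

section \<open>Closed form of psi2 through the Gamma function\<close>

lemma Gamma_reflection_quarter: "Gamma (1 / 4 :: real) * Gamma (3 / 4) = pi * sqrt 2"
proof -
  have "Gamma (complex_of_real (1 / 4)) * Gamma (1 - complex_of_real (1 / 4)) = of_real pi / sin (of_real pi * complex_of_real (1 / 4))"
    by (rule Gamma_reflection_complex)
  also have "1 - complex_of_real (1 / 4) = complex_of_real (3 / 4)"
    by simp
  also have "of_real pi * complex_of_real (1 / 4) = complex_of_real (pi / 4)" by simp
  finally have "complex_of_real (Gamma (1 / 4) * Gamma (3 / 4)) = complex_of_real (pi / sin (pi / 4))"
    by (simp only: Gamma_complex_of_real sin_of_real flip: of_real_mult of_real_divide)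
  then have "Gamma (1 / 4 :: real) * Gamma (3 / 4) = pi / sin (pi / 4)"
    by (simp only: of_real_eq_iff)
  also have "\<dots> = pi * sqrt 2" by (simp add: sin_45 field_simps)
  finally show ?thesis .
qed

text \<open>At t = 1 the arguments of the integral are in the ratio sqrt 2 : 1. Homogeneity then
  turns its value pi / 2 into an equation between \<open>Y\<close> and the lemniscatic integral, and
  reflection expresses the latter by Gamma at 3/4.\<close>

lemma psi2_eq: "psi2 = pi\<^sup>2 / Gamma (3 / 4) ^ 4"
proof -
  define q where "q = exp (- pi)"
  have q: "q \<in> {0<..<1}" by (auto simp: q_def)
  define X Y where "X = (nome_theta q)\<^sup>2" and "Y = (nome_theta (- q))\<^sup>2"
  have Y: "Y > 0" using nome_squares[OF q] by (simp add: Y_def)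
  have X: "X > 0" using nome_theta_pos[of q] q by (simp add: X_def)
  have X2: "X\<^sup>2 = 2 * Y\<^sup>2" using nome_theta_lemniscatic by (simp add: X_def Y_def q_def)
  then have "X\<^sup>2 = (Y * sqrt 2)\<^sup>2" by (simp add: power_mult_distrib)
  then have XY: "X = Y * sqrt 2" using X Y by (subst (asm) power2_eq_iff_nonneg) auto
  define G :: real where "G = Gamma (3 / 4)"
  have G: "G > 0" by (simp add: G_def Gamma_real_pos)
  have "agm_integral (Y * sqrt 2) (Y * 1) = pi / 2"
    using agm_integral_nome_theta[OF q] XY by (simp add: X_def Y_def)
  then have "Beta (1 / 4) (1 / 2) / 4 / Y = pi / 2"
    unfolding agm_integral_scale[OF Y] agm_integral_lemniscatic .
  moreover have "Beta (1 / 4) (1 / 2 :: real) = pi * sqrt 2 * sqrt pi / G\<^sup>2"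
  proof -
    have "Gamma (1 / 4) = pi * sqrt 2 / G"
      using Gamma_reflection_quarter[folded G_def] G by (simp add: field_simps)
    then show ?thesis by (simp add: Beta_def Gamma_one_half_real G_def[symmetric] power2_eq_square)
  qed
  ultimately have "Y = sqrt 2 * sqrt pi / (2 * G\<^sup>2)"
    using Y G by (simp add: field_simps)
  then have "2 * pi * Y\<^sup>2 = pi\<^sup>2 / G ^ 4"
    by (simp add: power_divide power_mult_distrib power2_eq_square power4_eq_xxxx)
  moreover have "psi2 = 2 * pi * Y\<^sup>2"
    using X2 by (simp add: psi2_def theta_eq_nome_theta X_def q_def)
  ultimately show ?thesis by (simp add: G_def)
qed

section \<open>The graded ring of derivatives and its values at 1\<close>

inductive graded_theta_poly :: "nat \<Rightarrow> (real \<Rightarrow> real) \<Rightarrow> bool" where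
  logderiv: "graded_theta_poly 1 theta_logderiv"
| odd: "graded_theta_poly 1 theta_odd"
| weight2: "graded_theta_poly 2 (\<lambda>t. (theta_weight2 t)\<^sup>2)"
| add: "graded_theta_poly k f \<Longrightarrow> graded_theta_poly k g \<Longrightarrow> graded_theta_poly k (\<lambda>t. f t + g t)"
| mult: "graded_theta_poly k f \<Longrightarrow> graded_theta_poly l g \<Longrightarrow> graded_theta_poly (k + l) (\<lambda>t. f t * g t)"
| scale: "graded_theta_poly k f \<Longrightarrow> graded_theta_poly k (\<lambda>t. of_rat c * f t)"

text \<open>Covers the term s^2 - u^2 common to the equations for l and u, with arbitrary rational
  coefficients.\<close>

lemma graded_theta_poly_discriminant:
  "graded_theta_poly 2 (\<lambda>t. of_rat c * (theta_weight2 t)\<^sup>2 + of_rat d * (theta_odd t * theta_odd t))"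
  using graded_theta_poly.intros(5)[OF graded_theta_poly.odd graded_theta_poly.odd]
  by (intro graded_theta_poly.add graded_theta_poly.scale graded_theta_poly.weight2) (simp only: one_add_one)

text \<open>On each generator the differential equations raise the weight by exactly one; sums and
  the product rule preserve this.\<close>

lemma graded_theta_poly_derivative:
  assumes "graded_theta_poly k f"
  shows "\<exists>g. graded_theta_poly (Suc k) g \<and> (\<forall>t>0. (f has_field_derivative g t) (at t))"
  using assms
proof induction
  case logderiv
  let ?g = "\<lambda>t. of_rat 2 * (theta_logderiv t * theta_logderiv t) +
    (of_rat (1 / 32) * (theta_weight2 t)\<^sup>2 + of_rat (- 1 / 32) * (theta_odd t * theta_odd t))"
  have "graded_theta_poly (1 + 1) (\<lambda>t. of_rat 2 * (theta_logderiv t * theta_logderiv t))"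
    by (intro graded_theta_poly.scale graded_theta_poly.mult graded_theta_poly.logderiv)
  then have "graded_theta_poly (Suc 1) ?g"
    using graded_theta_poly_discriminant[of "1 / 32" "- 1 / 32"]
    by (intro graded_theta_poly.add[of _ "\<lambda>t. of_rat 2 * (theta_logderiv t * theta_logderiv t)"])
      (simp_all only: Suc_1 one_add_one)
  moreover have "(theta_logderiv has_field_derivative ?g t) (at t)" if "t > 0" for t
    using theta_logderiv_has_derivative[OF that]
    by (simp add: of_rat_divide of_rat_minus power2_eq_square diff_divide_distrib)
  ultimately show ?case by blast
next
  case odd
  let ?g = "\<lambda>t. of_rat 4 * (theta_logderiv t * theta_odd t) +
    (of_rat (- 1 / 2) * (theta_weight2 t)\<^sup>2 + of_rat (1 / 2) * (theta_odd t * theta_odd t))"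
  have "graded_theta_poly (1 + 1) (\<lambda>t. of_rat 4 * (theta_logderiv t * theta_odd t))"
    by (intro graded_theta_poly.scale graded_theta_poly.mult graded_theta_poly.logderiv graded_theta_poly.odd)
  then have "graded_theta_poly (Suc 1) ?g"
    using graded_theta_poly_discriminant[of "- 1 / 2" "1 / 2"]
    by (intro graded_theta_poly.add[of _ "\<lambda>t. of_rat 4 * (theta_logderiv t * theta_odd t)"])
      (simp_all only: Suc_1 one_add_one)
  moreover have "(theta_odd has_field_derivative ?g t) (at t)" if "t > 0" for t
    using theta_odd_has_derivative[OF that]
    by (simp add: of_rat_divide of_rat_minus power2_eq_square diff_divide_distrib algebra_simps)
  ultimately show ?case by blast
next
  case weight2
  \<comment> \<open>The 8 comes from (s^2)' = 2 s s' with s' = 4 l s.\<close>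
  have "graded_theta_poly (1 + 2) (\<lambda>t. of_rat 8 * (theta_logderiv t * (theta_weight2 t)\<^sup>2))"
    by (intro graded_theta_poly.scale graded_theta_poly.mult graded_theta_poly.logderiv graded_theta_poly.weight2)
  moreover have "((\<lambda>t. (theta_weight2 t)\<^sup>2) has_field_derivative of_rat 8 * (theta_logderiv t * (theta_weight2 t)\<^sup>2)) (at t)"
    if "t > 0" for t
    using that by (auto intro!: derivative_eq_intros theta_weight2_has_derivative simp: power2_eq_square)
  ultimately show ?case by (intro exI conjI) (auto simp: numeral_eq_Suc)
next
  case (add k f g)
  then obtain f' g' where "graded_theta_poly (Suc k) f'" "graded_theta_poly (Suc k) g'"
    and "\<And>t. t > 0 \<Longrightarrow> (f has_field_derivative f' t) (at t)" "\<And>t. t > 0 \<Longrightarrow> (g has_field_derivative g' t) (at t)"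
    by blast
  then show ?case
    by (intro exI[of _ "\<lambda>t. f' t + g' t"]) (auto intro!: graded_theta_poly.add derivative_intros)
next
  case (mult k f l g)
  then obtain f' g' where f': "graded_theta_poly (Suc k) f'" and g': "graded_theta_poly (Suc l) g'"
    and "\<And>t. t > 0 \<Longrightarrow> (f has_field_derivative f' t) (at t)" "\<And>t. t > 0 \<Longrightarrow> (g has_field_derivative g' t) (at t)"
    by blast
  moreover have "graded_theta_poly (Suc (k + l)) (\<lambda>t. f' t * g t + f t * g' t)"
    using graded_theta_poly.mult[OF f' mult.hyps(2)] graded_theta_poly.mult[OF mult.hyps(1) g']
    by (intro graded_theta_poly.add) simp_all
  ultimately show ?case
    by (intro exI[of _ "\<lambda>t. f' t * g t + f t * g' t"]) (auto intro!: derivative_eq_intros)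
next
  case (scale k f c)
  then obtain f' where "graded_theta_poly (Suc k) f'"
    and "\<And>t. t > 0 \<Longrightarrow> (f has_field_derivative f' t) (at t)"
    by blast
  then show ?case
    by (intro exI[of _ "\<lambda>t. of_rat c * f' t"]) (auto intro!: graded_theta_poly.scale DERIV_cmult)
qed

lemma map_poly_of_rat_add:
  "map_poly of_rat (P + Q) = map_poly of_rat P + (map_poly of_rat Q :: real poly)"
  by (rule poly_eqI) (simp add: coeff_map_poly of_rat_add)

lemma map_poly_of_rat_mult:
  "map_poly of_rat (P * Q) = map_poly of_rat P * (map_poly of_rat Q :: real poly)"
  by (rule poly_eqI) (simp add: coeff_map_poly coeff_mult of_rat_sum of_rat_mult)

text \<open>At 1 the generators of weight 1 become the rational constants - 1 / 4 and 0, and the one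
  of weight 2 becomes the square of \<open>psi2\<close>. Evenness and the degree bound are thus
  inherited from the grading.\<close>

lemma graded_theta_poly_value:
  assumes "graded_theta_poly k f"
  shows "\<exists>P :: rat poly. f 1 = poly (map_poly of_rat P) psi2 \<and> (\<forall>x. poly P (- x) = poly P x) \<and> degree P \<le> k"
  using assms
proof induction
  case logderiv
  show ?case by (rule exI[of _ "[:- 1 / 4:]"]) (simp add: theta_logderiv_1 map_poly_pCons of_rat_divide of_rat_minus)
next
  case odd
  show ?case by (rule exI[of _ 0]) (simp add: theta_odd_1)
next
  case weight2
  show ?case
    by (rule exI[of _ "[:0, 0, 1:]"]) (simp add: theta_weight2_def psi2_def map_poly_pCons power2_eq_square)
next
  case (add k f g)
  then obtain P Q :: "rat poly" where "f 1 = poly (map_poly of_rat P) psi2" "g 1 = poly (map_poly of_rat Q) psi2"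
    "\<And>x. poly P (- x) = poly P x" "\<And>x. poly Q (- x) = poly Q x" "degree P \<le> k" "degree Q \<le> k"
    by blast
  then show ?case by (intro exI[of _ "P + Q"]) (auto simp: map_poly_of_rat_add intro: degree_add_le)
next
  case (mult k f l g)
  then obtain P Q :: "rat poly" where "f 1 = poly (map_poly of_rat P) psi2" "g 1 = poly (map_poly of_rat Q) psi2"
    "\<And>x. poly P (- x) = poly P x" "\<And>x. poly Q (- x) = poly Q x" "degree P \<le> k" "degree Q \<le> l"
    by blast
  then show ?case
    by (intro exI[of _ "P * Q"]) (auto simp: map_poly_of_rat_mult intro!: order_trans[OF degree_mult_le])
next
  case (scale k f c)
  then obtain P :: "rat poly" where P: "f 1 = poly (map_poly of_rat P) psi2"
    "\<And>x. poly P (- x) = poly P x" "degree P \<le> k"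
    by blast
  then show ?case
    by (intro exI[of _ "[:c:] * P"]) (auto simp: map_poly_of_rat_mult map_poly_pCons simp del: mult_pCons_left intro!: order_trans[OF degree_mult_le])
qed

text \<open>The claim is made on the whole half-line because the next \<open>deriv\<close> depends
  on values in a neighbourhood. It starts at the first derivative, which is a generator.\<close>

lemma deriv_ln_theta_graded:
  "\<exists>g. graded_theta_poly (Suc k) g \<and> (\<forall>t>0. (deriv ^^ Suc k) (\<lambda>t. ln (theta t)) t = g t)"
proof (induction k)
  case 0
  have "deriv (\<lambda>t. ln (theta t)) t = theta_logderiv t" if "t > 0" for t
  proof (rule DERIV_imp_deriv)
    show "((\<lambda>t. ln (theta t)) has_field_derivative theta_logderiv t) (at t)"
      using theta_pos[OF that] by (auto intro!: derivative_eq_intros theta_has_derivative that)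
  qed
  then show ?case using graded_theta_poly.logderiv by auto
next
  case (Suc k)
  then obtain f where f: "graded_theta_poly (Suc k) f"
    "\<And>t. t > 0 \<Longrightarrow> (deriv ^^ Suc k) (\<lambda>t. ln (theta t)) t = f t" by blast
  from graded_theta_poly_derivative[OF f(1)] obtain g where g: "graded_theta_poly (Suc (Suc k)) g"
    "\<And>t. t > 0 \<Longrightarrow> (f has_field_derivative g t) (at t)" by blast
  have "(deriv ^^ Suc (Suc k)) (\<lambda>t. ln (theta t)) t = g t" if "t > 0" for t
  proof -
    have "\<forall>\<^sub>F s in nhds t. s \<in> {0<..}" using that by (intro eventually_nhds_in_open) auto
    then have "\<forall>\<^sub>F s in nhds t. (deriv ^^ Suc k) (\<lambda>t. ln (theta t)) s = f s"
      by eventually_elim (use f(2) in auto)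
    then have "deriv ((deriv ^^ Suc k) (\<lambda>t. ln (theta t))) t = deriv f t"
      by (intro deriv_cong_ev refl)
    also have "\<dots> = g t" using g(2)[OF that] by (rule DERIV_imp_deriv)
    finally show ?thesis by simp
  qed
  then show ?case using g(1) by blast
qed

theorem theorem7p6:
  shows "psi2 = pi\<^sup>2 / Gamma (3/4) ^ 4 \<and>
    (\<forall>k::nat. k \<ge> 1 \<longrightarrow>
      (\<exists>P :: rat poly. R k = poly (map_poly of_rat P) psi2 \<and>
        (\<forall>x. poly P (- x) = poly P x) \<and> degree P \<le> k))"
proof (intro conjI allI impI psi2_eq)
  fix k :: nat
  assume "k \<ge> 1"
  then obtain m where m: "k = Suc m" by (cases k) auto
  obtain g where g: "graded_theta_poly (Suc m) g"
    "\<And>t. t > 0 \<Longrightarrow> (deriv ^^ Suc m) (\<lambda>t. ln (theta t)) t = g t"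
    using deriv_ln_theta_graded by blast
  have "R k = g 1" unfolding R_def m by (rule g(2)) simp
  then show "\<exists>P :: rat poly. R k = poly (map_poly of_rat P) psi2 \<and>
        (\<forall>x. poly P (- x) = poly P x) \<and> degree P \<le> k"
    using graded_theta_poly_value[OF g(1)] unfolding m by simp
qed

end
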